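(* The group $PLB_n^{ext}/\Gamma_2(WP_n)$ is a crystallographic group of dimension $n(n-1)$ and whose holonomy group is $(\mathbb{Z}_2)^n$.
   Context: Here $n\ge 1$ is an integer. A group $\Pi$ is crystallographic of dimension $m$ with holonomy group $\Phi$ if there is a short exact sequence $0\to\mathbb{Z}^m\to\Pi\to\Phi\to1$ with $\Phi$ finite such that the representation $\Phi\to\mathrm{Aut}(\mathbb{Z}^m)$ induced by conjugation is faithful. $\Gamma_2(H)=[H,H]$. The pure extended loop braid group $PLB_n^{ext}$ is the group of isotopy classes of self-homeomorphisms of the $3$-ball $B^3$ preserving each component of a trivial link $C=C_1\sqcup\cdots\sqcup C_n$ of $n$ oriented circles, without the requirement of preserving the orientation of $C$. It is known to have the following presentation: generators $\alpha_{i,j}$ ($1\le i\ne j\le n$) and $\tau_k$ ($1\le k\le n$); relations (different letters standing for different indices) $\alpha_{i,j}\alpha_{k,l}=\alpha_{k,l}\alpha_{i,j}$, $\alpha_{i,j}\alpha_{k,j}=\alpha_{k,j}\alpha_{i,j}$, $(\alpha_{i,j}\alpha_{k,j})\alpha_{i,k}=\alpha_{i,k}(\alpha_{i,j}\alpha_{k,j})$, $\tau_i^2=1$, $\tau_i\alpha_{i,j}=\alpha_{i,j}\tau_i$, $\tau_i\alpha_{j,k}=\alpha_{j,k}\tau_i$, $\tau_i\alpha_{j,i}\tau_i=\alpha_{j,i}^{-1}$. It is a semidirect product $WP_n\rtimes(\mathbb{Z}_2)^n$, where $(\mathbb{Z}_2)^n=\langle\tau_1,\dots,\tau_n\rangle$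 and the pure welded braid group $WP_n$ is the normal subgroup generated by the $\alpha_{i,j}$, which is presented by these generators and the first three families of relations.
   Formalization: Stated for n ≥ 2, since for n = 1 the quotient is Z_2 in dimension 0 and its action on Z^0 is not faithful; the relations τ_iτ_j = τ_jτ_i, missing from the quoted presentation but needed for ⟨τ_1,…,τ_n⟩ = (Z_2)^n, are included. *)

theory Defs
  imports "HOL-Algebra.Product_Groups" "HOL-Algebra.Bij" "HOL-Algebra.Generated_Groups"
begin

section \<open>Groups given by generators and relations\<close>

text \<open>A letter \<open>(x, True)\<close> stands for the generator \<open>x\<close> and \<open>(x, False)\<close> for its formal inverse.
  A pair \<open>(u, v)\<close> of words in a set of relations stands for the relation \<open>u = v\<close>.\<close>

type_synonym 'g word = "('g \<times> bool) list"

definition words :: "'g set \<Rightarrow> 'g word set" where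
  "words X = lists (X \<times> UNIV)"

lemma words_simps [simp]:
  "[] \<in> words X"
  "(x, b) # w \<in> words X \<longleftrightarrow> x \<in> X \<and> w \<in> words X"
  "u @ v \<in> words X \<longleftrightarrow> u \<in> words X \<and> v \<in> words X"
  by (auto simp: words_def)

inductive presented_cong :: "'g set \<Rightarrow> ('g word \<times> 'g word) set \<Rightarrow> 'g word \<Rightarrow> 'g word \<Rightarrow> bool"
  for X :: "'g set" and R :: "('g word \<times> 'g word) set" where
  refl: "w \<in> words X \<Longrightarrow> presented_cong X R w w"
| sym: "presented_cong X R u v \<Longrightarrow> presented_cong X R v u"
| trans: "presented_cong X R u v \<Longrightarrow> presented_cong X R v w \<Longrightarrow> presented_cong X R u w"
| append: "presented_cong X R u u' \<Longrightarrow> presented_cong X R v v' \<Longrightarrow>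
    presented_cong X R (u @ v) (u' @ v')"
| cancel: "x \<in> X \<Longrightarrow> presented_cong X R [(x, b), (x, \<not> b)] []"
| relation: "(u, v) \<in> R \<Longrightarrow> u \<in> words X \<Longrightarrow> v \<in> words X \<Longrightarrow>
    presented_cong X R u v"

definition word_class :: "'g set \<Rightarrow> ('g word \<times> 'g word) set \<Rightarrow> 'g word \<Rightarrow> 'g word set" where
  "word_class X R w = {v. presented_cong X R w v}"

definition presented_group :: "'g set \<Rightarrow> ('g word \<times> 'g word) set \<Rightarrow> 'g word set monoid" where
  "presented_group X R =
    \<lparr>carrier = word_class X R ` words X,
     monoid.mult = (\<lambda>A B. \<Union>u\<in>A. \<Union>v\<in>B. word_class X R (u @ v)),
     one = word_class X R []\<rparr>"

lemma presented_cong_lists: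
  "presented_cong X R u v \<Longrightarrow> u \<in> words X \<and> v \<in> words X"
  by (induction rule: presented_cong.induct) auto

lemma word_class_eq_iff:
  assumes "u \<in> words X"
  shows "word_class X R u = word_class X R v \<longleftrightarrow> presented_cong X R u v"
proof
  assume eq: "word_class X R u = word_class X R v"
  have "u \<in> word_class X R u"
    using assms by (simp add: word_class_def presented_cong.refl)
  then have "presented_cong X R v u"
    unfolding eq by (simp add: word_class_def)
  then show "presented_cong X R u v"
    by (rule presented_cong.sym)
next
  assume "presented_cong X R u v"
  then show "word_class X R u = word_class X R v"
    unfolding word_class_def by (blast intro: presented_cong.sym presented_cong.trans)
qed

lemma mult_word_class:
  assumes "u \<in> words X" "v \<in> words X"
  shows "word_class X R u \<otimes>\<^bsub>presented_group X R\<^esub> word_class X R v = word_class X R (u @ v)"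
proof -
  have self: "u \<in> word_class X R u" "v \<in> word_class X R v"
    using assms by (simp_all add: word_class_def presented_cong.refl)
  have "word_class X R (a @ b) = word_class X R (u @ v)"
    if "a \<in> word_class X R u" "b \<in> word_class X R v" for a b
  proof -
    have "presented_cong X R (u @ v) (a @ b)"
      using that by (simp add: word_class_def presented_cong.append)
    moreover have "u @ v \<in> words X"
      using assms by simp
    ultimately show ?thesis
      by (metis word_class_eq_iff)
  qed
  then have "(\<Union>a\<in>word_class X R u. \<Union>b\<in>word_class X R v. word_class X R (a @ b)) =
      word_class X R (u @ v)"
    using self by blast
  then show ?thesis
    by (simp add: presented_group_def)
qed

lemma inverse_word_words:
  "w \<in> words X \<Longrightarrow> rev (map (map_prod (\<lambda>x. x) Not) w) \<in> words X"
  by (induction w) auto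

lemma inverse_word:
  assumes "w \<in> words X"
  shows "presented_cong X R (rev (map (map_prod (\<lambda>x. x) Not) w) @ w) []"
  using assms
proof (induction w)
  case Nil
  then show ?case
    by (simp add: presented_cong.refl)
next
  case (Cons a w)
  obtain x b where a: "a = (x, b)"
    by (cases a)
  let ?w' = "rev (map (map_prod (\<lambda>x. x) Not) w)"
  have x: "x \<in> X" and w: "w \<in> words X"
    using Cons.prems a by simp_all
  have w': "?w' \<in> words X"
    using w by (rule inverse_word_words)
  have "presented_cong X R ([(x, \<not> b), (x, b)] @ w) ([] @ w)"
    using presented_cong.cancel[OF x, of R "\<not> b"] w
    by (intro presented_cong.append presented_cong.refl) simp_all
  then have "presented_cong X R (?w' @ [(x, \<not> b), (x, b)] @ w) (?w' @ w)"
    by (intro presented_cong.append[OF presented_cong.refl[OF w']]) simp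
  then have "presented_cong X R (?w' @ [(x, \<not> b), (x, b)] @ w) []"
    using Cons.IH[OF w] by (rule presented_cong.trans)
  then show ?case
    using a by simp
qed

lemma group_presented_group: "group (presented_group X R)"
proof (rule groupI)
  let ?G = "presented_group X R"
  have carr: "carrier ?G = word_class X R ` words X"
    and one: "\<one>\<^bsub>?G\<^esub> = word_class X R []"
    by (simp_all add: presented_group_def)
  show "\<one>\<^bsub>?G\<^esub> \<in> carrier ?G"
    by (auto simp: carr one)
  show "\<And>x y. x \<in> carrier ?G \<Longrightarrow> y \<in> carrier ?G \<Longrightarrow> x \<otimes>\<^bsub>?G\<^esub> y \<in> carrier ?G"
    by (auto simp: carr mult_word_class)
  show "\<And>x y z. x \<in> carrier ?G \<Longrightarrow> y \<in> carrier ?G \<Longrightarrow> z \<in> carrier ?G \<Longrightarrow>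
      x \<otimes>\<^bsub>?G\<^esub> y \<otimes>\<^bsub>?G\<^esub> z = x \<otimes>\<^bsub>?G\<^esub> (y \<otimes>\<^bsub>?G\<^esub> z)"
    by (auto simp: carr mult_word_class)
  show "\<And>x. x \<in> carrier ?G \<Longrightarrow> \<one>\<^bsub>?G\<^esub> \<otimes>\<^bsub>?G\<^esub> x = x"
    by (auto simp: carr one mult_word_class)
  show "\<exists>y\<in>carrier ?G. y \<otimes>\<^bsub>?G\<^esub> x = \<one>\<^bsub>?G\<^esub>" if xG: "x \<in> carrier ?G" for x
  proof -
    obtain w where w: "w \<in> words X" and x: "x = word_class X R w"
      using xG by (auto simp: carr)
    let ?w' = "rev (map (map_prod (\<lambda>x. x) Not) w)"
    have w': "?w' \<in> words X"
      using w by (rule inverse_word_words)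
    have "?w' @ w \<in> words X"
      using w w' by simp
    then have "word_class X R (?w' @ w) = word_class X R []"
      using inverse_word[OF w, of R] by (simp only: word_class_eq_iff)
    then have "word_class X R ?w' \<otimes>\<^bsub>?G\<^esub> x = \<one>\<^bsub>?G\<^esub>"
      unfolding x one by (simp only: mult_word_class[OF w' w])
    moreover have "word_class X R ?w' \<in> carrier ?G"
      using w' unfolding carr by (rule imageI)
    ultimately show ?thesis
      by (rule bexI)
  qed
qed

section \<open>The pure extended loop braid group\<close>

datatype plb_gen = Alpha nat nat | Tau nat

definition plb_gens :: "nat \<Rightarrow> plb_gen set" where
  "plb_gens n = {Alpha i j | i j. i \<in> {1..n} \<and> j \<in> {1..n} \<and> i \<noteq> j} \<union> Tau ` {1..n}"

abbreviation \<alpha> :: "nat \<Rightarrow> nat \<Rightarrow> plb_gen word" where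
  "\<alpha> i j \<equiv> [(Alpha i j, True)]"

abbreviation \<alpha>_inv :: "nat \<Rightarrow> nat \<Rightarrow> plb_gen word" where
  "\<alpha>_inv i j \<equiv> [(Alpha i j, False)]"

abbreviation \<tau> :: "nat \<Rightarrow> plb_gen word" where
  "\<tau> i \<equiv> [(Tau i, True)]"

text \<open>This is the presentation of the group of isotopy classes of self-homeomorphisms of the
  3-ball preserving each component of a trivial \<open>n\<close>-component link. The relations
  \<open>\<tau>\<^sub>i \<tau>\<^sub>j = \<tau>\<^sub>j \<tau>\<^sub>i\<close> are easily omitted from the list; without them the \<open>\<tau>\<^sub>i\<close> would generate a
  free product of copies of \<open>\<int>\<^sub>2\<close> instead of the complement \<open>(\<int>\<^sub>2)\<^sup>n\<close> of \<open>WP\<^sub>n\<close>.\<close>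

inductive_set plb_rels :: "nat \<Rightarrow> (plb_gen word \<times> plb_gen word) set" for n :: nat where
  alpha_comm: "\<lbrakk>{i, j, k, l} \<subseteq> {1..n}; distinct [i, j, k, l]\<rbrakk> \<Longrightarrow>
    (\<alpha> i j @ \<alpha> k l, \<alpha> k l @ \<alpha> i j) \<in> plb_rels n"
| alpha_comm_target: "\<lbrakk>{i, j, k} \<subseteq> {1..n}; distinct [i, j, k]\<rbrakk> \<Longrightarrow>
    (\<alpha> i j @ \<alpha> k j, \<alpha> k j @ \<alpha> i j) \<in> plb_rels n"
| alpha_mixed: "\<lbrakk>{i, j, k} \<subseteq> {1..n}; distinct [i, j, k]\<rbrakk> \<Longrightarrow>
    ((\<alpha> i j @ \<alpha> k j) @ \<alpha> i k, \<alpha> i k @ (\<alpha> i j @ \<alpha> k j)) \<in> plb_rels n"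
| tau_sq: "i \<in> {1..n} \<Longrightarrow> (\<tau> i @ \<tau> i, []) \<in> plb_rels n"
| tau_comm: "\<lbrakk>{i, j} \<subseteq> {1..n}; i \<noteq> j\<rbrakk> \<Longrightarrow> (\<tau> i @ \<tau> j, \<tau> j @ \<tau> i) \<in> plb_rels n"
| tau_alpha_source: "\<lbrakk>{i, j} \<subseteq> {1..n}; i \<noteq> j\<rbrakk> \<Longrightarrow>
    (\<tau> i @ \<alpha> i j, \<alpha> i j @ \<tau> i) \<in> plb_rels n"
| tau_alpha_disjoint: "\<lbrakk>{i, j, k} \<subseteq> {1..n}; distinct [i, j, k]\<rbrakk> \<Longrightarrow>
    (\<tau> i @ \<alpha> j k, \<alpha> j k @ \<tau> i) \<in> plb_rels n"
| tau_alpha_target: "\<lbrakk>{i, j} \<subseteq> {1..n}; i \<noteq> j\<rbrakk> \<Longrightarrow>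
    (\<tau> i @ \<alpha> j i @ \<tau> i, \<alpha>_inv j i) \<in> plb_rels n"

definition PLB_ext :: "nat \<Rightarrow> plb_gen word set monoid" where
  "PLB_ext n = presented_group (plb_gens n) (plb_rels n)"

text \<open>The pure welded braid group, realised inside the pure extended loop braid group.\<close>

definition WP :: "nat \<Rightarrow> plb_gen word set set" where
  "WP n = generate (PLB_ext n)
    {word_class (plb_gens n) (plb_rels n) (\<alpha> i j) | i j. i \<in> {1..n} \<and> j \<in> {1..n} \<and> i \<noteq> j}"

section \<open>Crystallographic groups\<close>

abbreviation Z_pow :: "nat \<Rightarrow> (nat \<Rightarrow> int) monoid" where
  "Z_pow m \<equiv> product_group {1..m} (\<lambda>_. integer_group)"

abbreviation Z2_pow :: "nat \<Rightarrow> (nat \<Rightarrow> int) monoid" where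
  "Z2_pow n \<equiv> product_group {1..n} (\<lambda>_. integer_mod_group 2)"

definition short_exact ::
  "('a, 'x) monoid_scheme \<Rightarrow> ('b, 'y) monoid_scheme \<Rightarrow> ('c, 'z) monoid_scheme \<Rightarrow>
    ('a \<Rightarrow> 'b) \<Rightarrow> ('b \<Rightarrow> 'c) \<Rightarrow> bool" where
  "short_exact A B C f g \<longleftrightarrow>
    group A \<and> group B \<and> group C \<and> f \<in> hom A B \<and> g \<in> hom B C \<and>
    inj_on f (carrier A) \<and> f ` carrier A = kernel B C g \<and> g ` carrier B = carrier C"

text \<open>\<open>\<rho>\<close> is the action of \<open>Q\<close> on \<open>\<int>\<^sup>m\<close> induced by conjugation in \<open>G\<close>. In a short exact sequence
  the last clause determines \<open>\<rho>\<close> on \<open>carrier Q\<close>, because \<open>\<iota>\<close> is injective and \<open>p\<close> is surjective.\<close>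

definition conj_rep ::
  "nat \<Rightarrow> ('a, 'x) monoid_scheme \<Rightarrow> ('b, 'y) monoid_scheme \<Rightarrow> ((nat \<Rightarrow> int) \<Rightarrow> 'a) \<Rightarrow> ('a \<Rightarrow> 'b) \<Rightarrow>
    ('b \<Rightarrow> (nat \<Rightarrow> int) \<Rightarrow> (nat \<Rightarrow> int)) \<Rightarrow> bool" where
  "conj_rep m G Q \<iota> p \<rho> \<longleftrightarrow>
    \<rho> \<in> hom Q (AutoGroup (Z_pow m)) \<and>
    (\<forall>g\<in>carrier G. \<forall>z\<in>carrier (Z_pow m). \<iota> (\<rho> (p g) z) = g \<otimes>\<^bsub>G\<^esub> \<iota> z \<otimes>\<^bsub>G\<^esub> inv\<^bsub>G\<^esub> g)"

text \<open>For \<open>m = 0\<close> faithfulness forces \<open>Q\<close> to be trivial. Hence \<open>PLB_ext 1\<close>, which is cyclic of order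
  two generated by \<open>\<tau>\<^sub>1\<close>, is not crystallographic of dimension 0 with holonomy group \<open>\<int>\<^sub>2\<close>.\<close>

definition crystallographic ::
  "('a, 'x) monoid_scheme \<Rightarrow> nat \<Rightarrow> ('b, 'y) monoid_scheme \<Rightarrow> bool" where
  "crystallographic G m Q \<longleftrightarrow>
    finite (carrier Q) \<and>
    (\<exists>\<iota> p \<rho>. short_exact (Z_pow m) G Q \<iota> p \<and> conj_rep m G Q \<iota> p \<rho> \<and> inj_on \<rho> (carrier Q))"

end

theory Submission
  imports Defs
begin

text \<open>
  The quotient of \<open>PLB_ext n\<close> by \<open>\<Gamma>\<^sub>2(WP n)\<close> is the semidirect product of \<open>\<int>\<^sup>m\<close>, \<open>m = n (n - 1)\<close>, with
  \<open>(\<int>\<^sub>2)\<^sup>n\<close>, where the lattice has one basis vector for every pair \<open>(i, j)\<close> of distinct indices and the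
  \<open>k\<close>-th generator of \<open>(\<int>\<^sub>2)\<^sup>n\<close> changes the sign of the basis vectors with \<open>j = k\<close>. Indeed, abelianising
  \<open>WP n\<close> turns the relations between the \<open>\<alpha>\<^sub>i\<^sub>j\<close> into mere commutation, so \<open>\<int>\<^sup>m\<close> is the abelianisation
  of \<open>WP n\<close>, and the remaining relations describe how the \<open>\<tau>\<^sub>k\<close> act on it. If \<open>n \<ge> 2\<close>, every index is
  the second component of some pair, so the action is faithful; and a semidirect product of a
  lattice with a finite group acting faithfully is crystallographic by its very construction
  (\<open>semidirect_product_crystallographic\<close>).

  To identify the quotient, \<open>\<alpha>\<^sub>i\<^sub>j\<close> is sent to a basis vector and \<open>\<tau>\<^sub>k\<close> to a generator of \<open>(\<int>\<^sub>2)\<^sup>n\<close>. The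
  defining relations hold in the semidirect product (\<open>rep_gen_relations\<close>), so this gives a
  homomorphism, which is onto (\<open>rep_onto\<close>). What needs an argument is that its kernel is no larger
  than \<open>\<Gamma>\<^sub>2(WP n)\<close> (\<open>kernel_rep\<close>). One observation about words is applied twice for this: if the
  letters of a word have commuting images in a group, then the word evaluates to the product of
  powers given by its exponent sums, hence to the identity as soon as each of these powers is
  trivial (\<open>word_eval_eq_one\<close>). Modulo \<open>WP n\<close>, where the \<open>\<tau>\<^sub>k\<close> are commuting involutions, it shows that an
  element with trivial \<open>(\<int>\<^sub>2)\<^sup>n\<close>-coordinate lies in \<open>WP n\<close> (\<open>even_tau_word_in_WP\<close>). Modulo \<open>\<Gamma>\<^sub>2(WP n)\<close>,
  where the \<open>\<alpha>\<^sub>i\<^sub>j\<close> commute, it shows that an element of \<open>WP n\<close> with trivial lattice coordinate is a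
  product of commutators (\<open>balanced_alpha_word_in_derived\<close>).
\<close>

section \<open>Evaluating words in a group\<close>

fun word_eval :: "('a, 'c) monoid_scheme \<Rightarrow> ('g \<Rightarrow> 'a) \<Rightarrow> 'g word \<Rightarrow> 'a" where
  "word_eval H f [] = \<one>\<^bsub>H\<^esub>"
| "word_eval H f ((x, b) # w) = (if b then f x else inv\<^bsub>H\<^esub> f x) \<otimes>\<^bsub>H\<^esub> word_eval H f w"

fun exp_sum :: "'g word \<Rightarrow> 'g \<Rightarrow> int" where
  "exp_sum [] x = 0"
| "exp_sum ((y, b) # w) x = (if y = x then (if b then 1 else - 1) else 0) + exp_sum w x"

lemma words_iff_set: "w \<in> words X \<longleftrightarrow> (\<forall>(x, b)\<in>set w. x \<in> X)"
  by (induction w) auto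

context group
begin

lemma word_eval_closed:
  assumes "f \<in> X \<rightarrow> carrier G" "w \<in> words X"
  shows "word_eval G f w \<in> carrier G"
  using assms(2)
proof (induction w)
  case (Cons a w)
  moreover obtain x b where "a = (x, b)"
    by fastforce
  moreover have "f x \<in> carrier G"
    using calculation assms(1) by auto
  ultimately show ?case
    by simp
qed simp

lemma word_eval_append:
  assumes "f \<in> X \<rightarrow> carrier G" "u \<in> words X" "v \<in> words X"
  shows "word_eval G f (u @ v) = word_eval G f u \<otimes> word_eval G f v"
  using assms(2)
proof (induction u)
  case (Cons a u)
  moreover obtain x b where "a = (x, b)"
    by fastforce
  moreover have "f x \<in> carrier G"
    using calculation assms(1) by auto
  ultimately show ?case
    using word_eval_closed[OF assms(1)] assms(3) by (simp add: m_assoc)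
qed (use word_eval_closed[OF assms(1,3)] in simp)

lemma word_eval_presented_cong:
  assumes f: "f \<in> X \<rightarrow> carrier G"
    and R: "\<And>u v. (u, v) \<in> R \<Longrightarrow> word_eval G f u = word_eval G f v"
    and "presented_cong X R u v"
  shows "word_eval G f u = word_eval G f v"
  using assms(3)
proof (induction rule: presented_cong.induct)
  case (append u u' v v')
  then show ?case
    using presented_cong_lists by (metis word_eval_append[OF f])
next
  case (cancel x b)
  then have "f x \<in> carrier G"
    using f by auto
  then show ?case
    by simp
qed (use R in auto)

text \<open>Von Dyck's theorem: a presentation is used to map out of the group. The value at a class
  is read off any representative, because evaluation is constant on classes.\<close>

lemma hom_from_presented_group:
  assumes f: "f \<in> X \<rightarrow> carrier G"
    and R: "\<And>u v. (u, v) \<in> R \<Longrightarrow> word_eval G f u = word_eval G f v"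
  obtains h where "h \<in> hom (presented_group X R) G"
    and "\<And>w. w \<in> words X \<Longrightarrow> h (word_class X R w) = word_eval G f w"
proof
  let ?h = "\<lambda>C. word_eval G f (SOME w. w \<in> C)"
  show eval: "?h (word_class X R w) = word_eval G f w" if "w \<in> words X" for w
  proof -
    have "w \<in> word_class X R w"
      using that by (simp add: word_class_def presented_cong.refl)
    then have "(SOME v. v \<in> word_class X R w) \<in> word_class X R w"
      by (rule someI)
    then show ?thesis
      using word_eval_presented_cong[OF f R] by (auto simp: word_class_def)
  qed
  show "?h \<in> hom (presented_group X R) G"
  proof (rule homI)
    fix C D
    assume "C \<in> carrier (presented_group X R)" "D \<in> carrier (presented_group X R)"
    then obtain u v where uv: "u \<in> words X" "v \<in> words X" "C = word_class X R u"
        "D = word_class X R v"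
      by (auto simp: presented_group_def)
    then show "?h C \<in> carrier G"
      using eval word_eval_closed[OF f] by simp
    show "?h (C \<otimes>\<^bsub>presented_group X R\<^esub> D) = ?h C \<otimes> ?h D"
      using uv by (simp add: mult_word_class eval word_eval_append[OF f])
  qed
qed

lemma hom_word_eval:
  assumes h: "h \<in> hom G H" and H: "group H" and f: "f \<in> X \<rightarrow> carrier G" and w: "w \<in> words X"
  shows "h (word_eval G f w) = word_eval H (h \<circ> f) w"
proof -
  interpret h: group_hom G H h
    using h H by (simp add: group_hom_def group_hom_axioms_def)
  show ?thesis
    using w
  proof (induction w)
    case (Cons a w)
    moreover obtain x b where "a = (x, b)"
      by fastforce
    moreover have "f x \<in> carrier G"
      using calculation f by auto
    ultimately show ?case
      using word_eval_closed[OF f] by simp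
  qed simp
qed

lemma commutes_inv:
  assumes "x \<in> carrier G" "y \<in> carrier G" "x \<otimes> y = y \<otimes> x"
  shows "inv x \<otimes> y = y \<otimes> inv x"
proof -
  have "x \<otimes> (y \<otimes> inv x) = y"
    using assms by (simp add: m_assoc[symmetric]) (simp add: m_assoc)
  then show ?thesis
    using assms by (simp add: inv_solve_left')
qed

lemma commutes_int_pow:
  fixes k :: int
  assumes "x \<in> carrier G" "y \<in> carrier G" "x \<otimes> y = y \<otimes> x"
  shows "x [^] k \<otimes> y = y \<otimes> x [^] k"
proof (cases k)
  case (nonneg i)
  then show ?thesis
    using group_commutes_pow[OF assms(3,1,2)] by (simp add: int_pow_int)
next
  case (neg i)
  then show ?thesis
    using commutes_inv[OF _ assms(2) group_commutes_pow[OF assms(3,1,2)]] assms(1)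
    by (simp only: int_pow_neg_int nat_pow_closed)
qed

lemma word_eval_commutes:
  assumes y: "y \<in> carrier G" and "\<forall>(x, b)\<in>set w. f x \<in> carrier G \<and> f x \<otimes> y = y \<otimes> f x"
  shows "word_eval G f w \<in> carrier G \<and> word_eval G f w \<otimes> y = y \<otimes> word_eval G f w"
  using assms(2)
proof (induction w)
  case (Cons a w)
  obtain x b where a: "a = (x, b)"
    by fastforce
  let ?l = "if b then f x else inv f x"
  have fx: "f x \<in> carrier G" "f x \<otimes> y = y \<otimes> f x"
    using Cons.prems a by auto
  then have l: "?l \<in> carrier G" "?l \<otimes> y = y \<otimes> ?l"
    using y commutes_inv by auto
  have IH: "word_eval G f w \<in> carrier G" "word_eval G f w \<otimes> y = y \<otimes> word_eval G f w"
    using Cons by auto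
  have "?l \<otimes> word_eval G f w \<otimes> y = y \<otimes> (?l \<otimes> word_eval G f w)"
    using m_assoc[OF l(1) IH(1) y] m_assoc[OF l(1) y IH(1)] m_assoc[OF y l(1) IH(1)] l(2) IH(2)
    by (simp only:)
  then show ?case
    using l IH a by simp
qed (use y in simp)

text \<open>Moving a letter that commutes with all others to the front collects its occurrences into a
  single power, whose exponent is the exponent sum.\<close>

lemma word_eval_collect:
  assumes x: "f x \<in> carrier G"
    and comm: "\<forall>(y, b)\<in>set w. f y \<in> carrier G \<and> f y \<otimes> f x = f x \<otimes> f y"
  shows "word_eval G f w =
    f x [^] exp_sum w x \<otimes> word_eval G f (filter (\<lambda>(y, b). y \<noteq> x) w)"
  using comm
proof (induction w)
  case (Cons a w)
  obtain y b where a: "a = (y, b)"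
    by fastforce
  let ?v = "word_eval G f (filter (\<lambda>(y, b). y \<noteq> x) w)"
  have IH: "word_eval G f w = f x [^] exp_sum w x \<otimes> ?v"
    using Cons by auto
  have v: "?v \<in> carrier G"
    using word_eval_commutes[OF x, of "filter (\<lambda>(y, b). y \<noteq> x) w"] Cons.prems by auto
  let ?l = "if b then f y else inv f y"
  show ?case
  proof (cases "y = x")
    case True
    have "?l = f x [^] (if b then 1 else - 1 :: int)"
      using True int_pow_neg[OF x, of 1] x by simp
    then have "word_eval G f (a # w) =
        f x [^] (if b then 1 else - 1 :: int) \<otimes> (f x [^] exp_sum w x \<otimes> ?v)"
      using a IH by simp
    also have "\<dots> = f x [^] ((if b then 1 else - 1) + exp_sum w x) \<otimes> ?v"
      using v x by (simp only: int_pow_mult m_assoc int_pow_closed)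
    finally show ?thesis
      using a True by simp
  next
    case False
    have "word_eval G f [(y, b)] \<in> carrier G"
      and "word_eval G f [(y, b)] \<otimes> f x = f x \<otimes> word_eval G f [(y, b)]"
      using word_eval_commutes[OF x, of "[(y, b)]"] Cons.prems a by auto
    then have l: "?l \<in> carrier G" "?l \<otimes> f x = f x \<otimes> ?l"
      using Cons.prems a by auto
    let ?p = "f x [^] exp_sum w x"
    have "?l \<otimes> ?p = ?p \<otimes> ?l"
      using commutes_int_pow[OF x l(1)] l(2) by simp
    then have "?l \<otimes> (?p \<otimes> ?v) = ?p \<otimes> (?l \<otimes> ?v)"
      using l(1) x v m_assoc[of ?l ?p ?v] m_assoc[of ?p ?l ?v] by (simp only: int_pow_closed)
    moreover have "word_eval G f (a # w) = ?l \<otimes> (?p \<otimes> ?v)"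
      using a IH by simp
    moreover have "exp_sum (a # w) x = exp_sum w x"
      and "word_eval G f (filter (\<lambda>(y, b). y \<noteq> x) (a # w)) = ?l \<otimes> ?v"
      using a False by simp_all
    ultimately show ?thesis
      by metis
  qed
next
  case Nil
  show ?case
    by (simp only: word_eval.simps exp_sum.simps filter.simps int_pow_0 l_one one_closed)
qed

text \<open>Collecting one letter after another turns the word into a product of the powers
  \<open>f x [^] exp_sum w x\<close>. Asking only that these powers vanish, rather than the exponent sums
  themselves, lets the lemma serve letters of finite order (sums that are merely even, for
  involutions) as well as letters of infinite order (sums equal to zero).\<close>

lemma word_eval_eq_one:
  assumes "\<And>x b y c. (x, b) \<in> set w \<Longrightarrow> (y, c) \<in> set w \<Longrightarrow> f x \<otimes> f y = f y \<otimes> f x"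
    and "\<And>x b. (x, b) \<in> set w \<Longrightarrow> f x \<in> carrier G \<and> f x [^] exp_sum w x = \<one>"
  shows "word_eval G f w = \<one>"
  using assms
proof (induction w rule: length_induct)
  case (1 w)
  show ?case
  proof (cases w)
    case (Cons a w')
    obtain x b where a: "a = (x, b)"
      by fastforce
    let ?v = "filter (\<lambda>(y, b). y \<noteq> x) w"
    have x: "f x \<in> carrier G" "f x [^] exp_sum w x = \<one>"
      using "1.prems"(2)[of x b] Cons a by simp_all
    have sum: "exp_sum ?v y = exp_sum w y" if "y \<noteq> x" for y
      using that by (induction w) auto
    have "length ?v < length w"
      using Cons a by (simp add: le_imp_less_Suc)
    moreover have "f y \<in> carrier G \<and> f y [^] exp_sum ?v y = \<one>" if "(y, c) \<in> set ?v" for y c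
      using "1.prems"(2)[of y c] that sum by auto
    moreover have "f y \<otimes> f z = f z \<otimes> f y" if "(y, c) \<in> set ?v" "(z, d) \<in> set ?v" for y c z d
      using "1.prems"(1)[of y c z d] that by simp
    ultimately have v: "word_eval G f ?v = \<one>"
      using "1.IH" by blast
    have "\<forall>(y, c)\<in>set w. f y \<in> carrier G \<and> f y \<otimes> f x = f x \<otimes> f y"
      using "1.prems"(1)[of _ _ x b] "1.prems"(2) Cons a by simp blast
    then have "word_eval G f w = f x [^] exp_sum w x \<otimes> word_eval G f ?v"
      by (rule word_eval_collect[where f = f, OF x(1)])
    then show ?thesis
      using v x by simp
  qed simp
qed

end

text \<open>Together with \<open>hom_word_eval\<close> this makes every homomorphism out of a presented group an
  evaluation of words, so that triviality in a quotient can be tested on words.\<close>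

lemma word_class_eq_word_eval:
  assumes "w \<in> words X"
  shows "word_class X R w =
    word_eval (presented_group X R) (\<lambda>x. word_class X R [(x, True)]) w"
  using assms
proof (induction w)
  case Nil
  then show ?case
    by (simp add: presented_group_def)
next
  case (Cons a w)
  interpret group "presented_group X R"
    by (rule group_presented_group)
  obtain x b where a: "a = (x, b)" and x: "x \<in> X" and w: "w \<in> words X"
    using Cons.prems by (cases a) auto
  have carr: "word_class X R [(x, c)] \<in> carrier (presented_group X R)" for c
    using x by (simp add: presented_group_def)
  have "word_class X R [(x, False)] \<otimes>\<^bsub>presented_group X R\<^esub> word_class X R [(x, True)]
      = \<one>\<^bsub>presented_group X R\<^esub>"
    using presented_cong.cancel[OF x, of R False] x
    by (simp add: mult_word_class word_class_eq_iff) (simp add: presented_group_def word_class_eq_iff)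
  then have "inv\<^bsub>presented_group X R\<^esub> word_class X R [(x, True)] = word_class X R [(x, False)]"
    using carr by (simp add: inv_equality)
  moreover have "word_class X R (a # w) =
      word_class X R [(x, b)] \<otimes>\<^bsub>presented_group X R\<^esub> word_class X R w"
    using a x w by (simp add: mult_word_class)
  ultimately show ?case
    using Cons.IH[OF w] a by simp
qed

section \<open>Semidirect products as crystallographic groups\<close>

definition semidirect_product ::
  "('a, 'x) monoid_scheme \<Rightarrow> ('q, 'y) monoid_scheme \<Rightarrow> ('q \<Rightarrow> 'a \<Rightarrow> 'a) \<Rightarrow> ('a \<times> 'q) monoid" where
  "semidirect_product A Q \<rho> =
    \<lparr>carrier = carrier A \<times> carrier Q,
     monoid.mult = (\<lambda>(a, q) (b, r). (a \<otimes>\<^bsub>A\<^esub> \<rho> q b, q \<otimes>\<^bsub>Q\<^esub> r)),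
     one = (\<one>\<^bsub>A\<^esub>, \<one>\<^bsub>Q\<^esub>)\<rparr>"

lemma semidirect_product_simps [simp]:
  "carrier (semidirect_product A Q \<rho>) = carrier A \<times> carrier Q"
  "(a, q) \<otimes>\<^bsub>semidirect_product A Q \<rho>\<^esub> (b, r) = (a \<otimes>\<^bsub>A\<^esub> \<rho> q b, q \<otimes>\<^bsub>Q\<^esub> r)"
  "\<one>\<^bsub>semidirect_product A Q \<rho>\<^esub> = (\<one>\<^bsub>A\<^esub>, \<one>\<^bsub>Q\<^esub>)"
  by (simp_all add: semidirect_product_def)

locale group_action_by_auto = A: group A + Q: group Q
  for A (structure) and Q (structure) +
  fixes \<rho>
  assumes rho_hom: "\<rho> \<in> hom Q (AutoGroup A)"
begin

lemma rho_auto: "q \<in> carrier Q \<Longrightarrow> \<rho> q \<in> auto A"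
  using rho_hom by (auto simp: hom_def AutoGroup_def)

lemma rho_closed: "q \<in> carrier Q \<Longrightarrow> a \<in> carrier A \<Longrightarrow> \<rho> q a \<in> carrier A"
  using rho_auto by (auto simp: auto_def hom_def)

lemma rho_mult_A: "q \<in> carrier Q \<Longrightarrow> a \<in> carrier A \<Longrightarrow> b \<in> carrier A \<Longrightarrow>
    \<rho> q (a \<otimes>\<^bsub>A\<^esub> b) = \<rho> q a \<otimes>\<^bsub>A\<^esub> \<rho> q b"
  using rho_auto by (auto simp: auto_def hom_def)

lemma rho_mult_Q: "q \<in> carrier Q \<Longrightarrow> r \<in> carrier Q \<Longrightarrow> a \<in> carrier A \<Longrightarrow>
    \<rho> (q \<otimes>\<^bsub>Q\<^esub> r) a = \<rho> q (\<rho> r a)"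
  using rho_hom rho_auto[of q] rho_auto[of r]
  by (auto simp: hom_def AutoGroup_def BijGroup_def auto_def compose_def)

lemma rho_one: "a \<in> carrier A \<Longrightarrow> \<rho> \<one>\<^bsub>Q\<^esub> a = a"
proof -
  interpret group_hom Q "AutoGroup A" \<rho>
    using rho_hom A.AutoGroup Q.group_axioms by (simp add: group_hom_def group_hom_axioms_def)
  show "a \<in> carrier A \<Longrightarrow> \<rho> \<one>\<^bsub>Q\<^esub> a = a"
    using hom_one by (simp add: AutoGroup_def BijGroup_def)
qed

lemma rho_fixes_one: "q \<in> carrier Q \<Longrightarrow> \<rho> q \<one>\<^bsub>A\<^esub> = \<one>\<^bsub>A\<^esub>"
  using rho_auto[of q] hom_one[OF _ A.group_axioms A.group_axioms] by (auto simp: auto_def)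

lemma group_semidirect_product: "group (semidirect_product A Q \<rho>)"
proof (rule groupI)
  fix x assume "x \<in> carrier (semidirect_product A Q \<rho>)"
  then obtain a q where aq: "x = (a, q)" "a \<in> carrier A" "q \<in> carrier Q"
    by auto
  show "\<exists>y\<in>carrier (semidirect_product A Q \<rho>). y \<otimes>\<^bsub>semidirect_product A Q \<rho>\<^esub> x =
      \<one>\<^bsub>semidirect_product A Q \<rho>\<^esub>"
    by (rule bexI[where x = "(\<rho> (inv\<^bsub>Q\<^esub> q) (inv\<^bsub>A\<^esub> a), inv\<^bsub>Q\<^esub> q)"])
      (use aq in \<open>auto simp: rho_closed rho_fixes_one simp flip: rho_mult_A\<close>)
qed (auto simp: rho_closed rho_mult_A rho_mult_Q rho_one A.m_assoc Q.m_assoc)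

text \<open>Conjugation by \<open>(a, q)\<close> acts on the kernel \<open>A\<close> through \<open>\<rho> q\<close> alone: the contribution of \<open>a\<close> is
  an inner automorphism, and these are trivial because \<open>A\<close> is abelian.\<close>

lemma conj_in_semidirect_product:
  assumes "comm_group A" "a \<in> carrier A" "q \<in> carrier Q" "z \<in> carrier A"
  shows "(\<rho> q z, \<one>\<^bsub>Q\<^esub>) =
    (a, q) \<otimes>\<^bsub>semidirect_product A Q \<rho>\<^esub> (z, \<one>\<^bsub>Q\<^esub>)
      \<otimes>\<^bsub>semidirect_product A Q \<rho>\<^esub> inv\<^bsub>semidirect_product A Q \<rho>\<^esub> (a, q)"
proof -
  interpret comm_group A by fact
  interpret S: group "semidirect_product A Q \<rho>" by (rule group_semidirect_product)
  have "(\<rho> q z, \<one>\<^bsub>Q\<^esub>) \<otimes>\<^bsub>semidirect_product A Q \<rho>\<^esub> (a, q) =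
      (a, q) \<otimes>\<^bsub>semidirect_product A Q \<rho>\<^esub> (z, \<one>\<^bsub>Q\<^esub>)"
    using assms by (simp add: rho_one rho_closed m_comm)
  then show ?thesis
    using assms by (intro S.inv_solve_right[THEN iffD2]) (auto simp: rho_closed)
qed

end

lemma comm_group_Z_pow: "comm_group (Z_pow m)"
  by (rule group.group_comm_groupI) (auto simp: fun_eq_iff)

text \<open>The holonomy representation of a split extension of a finite group by a lattice is the action
  itself, so faithfulness of the action is all that has to be known.\<close>

lemma semidirect_product_crystallographic:
  assumes "group Q" "finite (carrier Q)"
    and rho: "\<rho> \<in> hom Q (AutoGroup (Z_pow m))" and inj: "inj_on \<rho> (carrier Q)"
  shows "crystallographic (semidirect_product (Z_pow m) Q \<rho>) m Q"
proof -
  interpret Z: comm_group "Z_pow m"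
    by (rule comm_group_Z_pow)
  interpret group_action_by_auto "Z_pow m" Q \<rho>
    using assms by (simp add: group_action_by_auto_def group_action_by_auto_axioms_def
        Z.group_axioms)
  let ?E = "semidirect_product (Z_pow m) Q \<rho>" and ?i = "\<lambda>z. (z, \<one>\<^bsub>Q\<^esub>)"
  have "short_exact (Z_pow m) ?E Q ?i snd"
    unfolding short_exact_def
  proof (intro conjI)
    show "?i \<in> hom (Z_pow m) ?E"
      by (rule homI) (use rho_one in auto)
    show "snd \<in> hom ?E Q"
      by (rule homI) auto
    show "snd ` carrier ?E = carrier Q"
      using Z.one_closed by (force simp: image_iff)
  qed (use Z.group_axioms \<open>group Q\<close> group_semidirect_product in
      \<open>auto simp: inj_on_def kernel_def\<close>)
  moreover have "conj_rep m ?E Q ?i snd \<rho>"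
    unfolding conj_rep_def
  proof (intro conjI ballI)
    show "\<rho> \<in> hom Q (AutoGroup (Z_pow m))"
      by (rule rho)
    fix g z assume g: "g \<in> carrier ?E" and z: "z \<in> carrier (Z_pow m)"
    obtain a q where "g = (a, q)" "a \<in> carrier (Z_pow m)" "q \<in> carrier Q"
      using g by (metis SigmaE semidirect_product_simps(1))
    then show "?i (\<rho> (snd g) z) = g \<otimes>\<^bsub>?E\<^esub> ?i z \<otimes>\<^bsub>?E\<^esub> inv\<^bsub>?E\<^esub> g"
      using conj_in_semidirect_product[OF Z.comm_group_axioms, of a q z] z
      by (simp only: snd_conv)
  qed
  ultimately show ?thesis
    using assms unfolding crystallographic_def by blast
qed

lemma crystallographic_iso:
  assumes H: "crystallographic H m Q" and G: "group G" and phi: "\<phi> \<in> iso G H"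
  shows "crystallographic G m Q"
proof -
  obtain \<iota> p \<rho> where fin: "finite (carrier Q)" and ex: "short_exact (Z_pow m) H Q \<iota> p"
    and rep: "conj_rep m H Q \<iota> p \<rho>" and inj: "inj_on \<rho> (carrier Q)"
    using H by (auto simp: crystallographic_def)
  interpret H: group H
    using ex by (simp add: short_exact_def)
  interpret G: group G by fact
  define \<psi> where "\<psi> = inv_into (carrier G) \<phi>"
  have psi: "\<psi> \<in> iso H G"
    unfolding \<psi>_def using phi by (rule G.iso_set_sym)
  interpret phi: group_hom G H \<phi>
    using phi by (simp add: group_hom_def group_hom_axioms_def iso_def G H.group_axioms)
  interpret psi: group_hom H G \<psi>
    using psi by (simp add: group_hom_def group_hom_axioms_def iso_def G H.group_axioms)
  have bij: "bij_betw \<phi> (carrier G) (carrier H)"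
    using phi by (simp add: iso_def)
  have phi_psi: "\<phi> (\<psi> y) = y" if "y \<in> carrier H" for y
    using that bij unfolding \<psi>_def by (simp add: bij_betw_inv_into_right)
  have psi_phi: "\<psi> (\<phi> x) = x" if "x \<in> carrier G" for x
    using that bij unfolding \<psi>_def by (simp add: bij_betw_inv_into_left)
  have i: "\<iota> \<in> hom (Z_pow m) H" "inj_on \<iota> (carrier (Z_pow m))"
      "\<iota> ` carrier (Z_pow m) = kernel H Q p" and p: "p \<in> hom H Q" "p ` carrier H = carrier Q"
    using ex by (simp_all add: short_exact_def)
  have iH: "\<iota> z \<in> carrier H" if "z \<in> carrier (Z_pow m)" for z
    using i(1) that by (auto simp only: hom_def)
  have "short_exact (Z_pow m) G Q (\<psi> \<circ> \<iota>) (p \<circ> \<phi>)"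
    unfolding short_exact_def
  proof (intro conjI)
    show "group (Z_pow m)" "group Q" "group G"
      using ex G by (simp_all add: short_exact_def)
    show "\<psi> \<circ> \<iota> \<in> hom (Z_pow m) G"
      using i(1) psi.homh by (rule hom_compose)
    show "p \<circ> \<phi> \<in> hom G Q"
      using phi.homh p(1) by (rule hom_compose)
    show "inj_on (\<psi> \<circ> \<iota>) (carrier (Z_pow m))"
    proof (rule comp_inj_on[OF i(2)])
      show "inj_on \<psi> (\<iota> ` carrier (Z_pow m))"
        by (rule inj_on_inverseI[where g = \<phi>]) (use iH phi_psi in blast)
    qed
    have "\<psi> ` kernel H Q p = kernel G Q (p \<circ> \<phi>)"
    proof
      show "\<psi> ` kernel H Q p \<subseteq> kernel G Q (p \<circ> \<phi>)"
        by (auto simp: kernel_def phi_psi)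
      show "kernel G Q (p \<circ> \<phi>) \<subseteq> \<psi> ` kernel H Q p"
      proof
        fix x assume "x \<in> kernel G Q (p \<circ> \<phi>)"
        then show "x \<in> \<psi> ` kernel H Q p"
          by (intro image_eqI[of _ _ "\<phi> x"]) (auto simp: kernel_def psi_phi)
      qed
    qed
    then show "(\<psi> \<circ> \<iota>) ` carrier (Z_pow m) = kernel G Q (p \<circ> \<phi>)"
      using i(3) by (metis image_comp)
    show "(p \<circ> \<phi>) ` carrier G = carrier Q"
      using p(2) bij by (metis bij_betw_def image_comp)
  qed
  moreover have "conj_rep m G Q (\<psi> \<circ> \<iota>) (p \<circ> \<phi>) \<rho>"
    unfolding conj_rep_def
  proof (intro conjI ballI)
    show "\<rho> \<in> hom Q (AutoGroup (Z_pow m))"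
      using rep by (simp add: conj_rep_def)
    fix g z assume g: "g \<in> carrier G" and z: "z \<in> carrier (Z_pow m)"
    have "\<iota> (\<rho> (p (\<phi> g)) z) = \<phi> g \<otimes>\<^bsub>H\<^esub> \<iota> z \<otimes>\<^bsub>H\<^esub> inv\<^bsub>H\<^esub> \<phi> g"
      using rep phi.hom_closed[OF g] z unfolding conj_rep_def by blast
    then show "(\<psi> \<circ> \<iota>) (\<rho> ((p \<circ> \<phi>) g) z) = g \<otimes>\<^bsub>G\<^esub> (\<psi> \<circ> \<iota>) z \<otimes>\<^bsub>G\<^esub> inv\<^bsub>G\<^esub> g"
      using g iH[OF z] by (simp add: psi_phi)
  qed
  ultimately show ?thesis
    using fin inj unfolding crystallographic_def by blast
qed

section \<open>Generation of direct products by their factors\<close>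

definition single :: "'i set \<Rightarrow> ('i \<Rightarrow> ('a, 'b) monoid_scheme) \<Rightarrow> 'i \<Rightarrow> 'a \<Rightarrow> 'i \<Rightarrow> 'a" where
  "single I G i x = (\<lambda>j\<in>I. if j = i then x else \<one>\<^bsub>G j\<^esub>)"

lemma single_hom:
  assumes "\<And>j. j \<in> I \<Longrightarrow> group (G j)"
  shows "single I G i \<in> hom (G i) (product_group I G)"
proof (rule homI)
  show "single I G i x \<in> carrier (product_group I G)" if "x \<in> carrier (G i)" for x
    using assms that by (auto simp: single_def group.is_monoid)
  show "single I G i (x \<otimes>\<^bsub>G i\<^esub> y) =
      single I G i x \<otimes>\<^bsub>product_group I G\<^esub> single I G i y" for x y
    using assms by (auto simp: single_def group.is_monoid fun_eq_iff)
qed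

text \<open>A finite direct product is generated by its factors, by induction on the support.\<close>

lemma hom_image_product_group_subset:
  assumes fin: "finite I" and G: "\<And>i. i \<in> I \<Longrightarrow> group (G i)"
    and h: "h \<in> hom (product_group I G) H" and S: "subgroup S H" and H: "group H"
    and single: "\<And>i x. i \<in> I \<Longrightarrow> x \<in> carrier (G i) \<Longrightarrow> h (single I G i x) \<in> S"
  shows "h ` carrier (product_group I G) \<subseteq> S"
proof -
  interpret P: group "product_group I G"
    by (rule product_group) (rule G)
  interpret h: group_hom "product_group I G" H h
    using h H by (simp add: group_hom_def group_hom_axioms_def P.group_axioms)
  have "h z \<in> S" if "J \<subseteq> I" "z \<in> carrier (product_group I G)" "\<forall>i\<in>I - J. z i = \<one>\<^bsub>G i\<^esub>" for J z
    using finite_subset[OF that(1) fin] that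
  proof (induction J arbitrary: z)
    case empty
    then have "z = \<one>\<^bsub>product_group I G\<^esub>"
      by (auto simp: fun_eq_iff PiE_iff extensional_def)
    then show ?case
      using subgroup.one_closed[OF S] h.hom_one by metis
  next
    case (insert i J)
    let ?z = "z(i := \<one>\<^bsub>G i\<^esub>)"
    have i: "i \<in> I" and zi: "z i \<in> carrier (G i)" and Gi: "group (G i)"
      using insert.prems G by auto
    have z': "?z \<in> carrier (product_group I G)"
      using insert.prems(2) i Gi by (auto simp: PiE_iff extensional_def group.is_monoid)
    have "single I G i (z i) \<in> carrier (product_group I G)"
      using single_hom[of I G i, OF G] zi by (auto simp only: hom_def)
    moreover have "z = single I G i (z i) \<otimes>\<^bsub>product_group I G\<^esub> ?z"
      using insert.prems(2) i Gi G
      by (auto simp: fun_eq_iff single_def PiE_iff extensional_def group.is_monoid)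
    ultimately have "h z = h (single I G i (z i)) \<otimes>\<^bsub>H\<^esub> h ?z"
      using z' h.hom_mult by metis
    moreover have "h ?z \<in> S"
      using insert.prems by (intro insert.IH[OF _ z']) auto
    ultimately show ?case
      using single[OF i zi] subgroup.m_closed[OF S] by simp
  qed
  then show ?thesis
    by blast
qed

section \<open>The pure welded braid subgroup\<close>

abbreviation plb_class :: "nat \<Rightarrow> plb_gen word \<Rightarrow> plb_gen word set" where
  "plb_class n \<equiv> word_class (plb_gens n) (plb_rels n)"

abbreviation plb_letter :: "nat \<Rightarrow> plb_gen \<Rightarrow> plb_gen word set" where
  "plb_letter n x \<equiv> plb_class n [(x, True)]"

definition alpha_gens :: "nat \<Rightarrow> plb_gen set" where
  "alpha_gens n = {Alpha i j | i j. i \<in> {1..n} \<and> j \<in> {1..n} \<and> i \<noteq> j}"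

lemma alpha_gens_subset: "alpha_gens n \<subseteq> plb_gens n"
  by (auto simp: alpha_gens_def plb_gens_def)

lemma plb_gens_simps [simp]:
  "Alpha i j \<in> plb_gens n \<longleftrightarrow> i \<in> {1..n} \<and> j \<in> {1..n} \<and> i \<noteq> j"
  "Tau i \<in> plb_gens n \<longleftrightarrow> i \<in> {1..n}"
  by (auto simp: plb_gens_def)

lemma plb_gens_cases:
  assumes "x \<in> plb_gens n"
  obtains (alpha) i j where "x = Alpha i j" "i \<in> {1..n}" "j \<in> {1..n}" "i \<noteq> j"
  | (tau) i where "x = Tau i" "i \<in> {1..n}"
  using assms by (auto simp: plb_gens_def)

lemma group_PLB_ext: "group (PLB_ext n)"
  unfolding PLB_ext_def by (rule group_presented_group)

lemma carrier_PLB_ext: "carrier (PLB_ext n) = plb_class n ` words (plb_gens n)"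
  by (simp add: PLB_ext_def presented_group_def)

lemma plb_letter_closed: "x \<in> plb_gens n \<Longrightarrow> plb_letter n x \<in> carrier (PLB_ext n)"
  by (simp add: carrier_PLB_ext)

lemma plb_class_eq_word_eval:
  "w \<in> words (plb_gens n) \<Longrightarrow> plb_class n w = word_eval (PLB_ext n) (plb_letter n) w"
  unfolding PLB_ext_def by (rule word_class_eq_word_eval)

lemma plb_class_inverse_letter:
  assumes "x \<in> plb_gens n"
  shows "plb_class n [(x, False)] = inv\<^bsub>PLB_ext n\<^esub> plb_letter n x"
proof -
  interpret group "PLB_ext n"
    by (rule group_PLB_ext)
  have "plb_letter n x \<in> carrier (PLB_ext n)"
    using assms by (rule plb_letter_closed)
  then show ?thesis
    using plb_class_eq_word_eval[of "[(x, False)]" n] assms by simp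
qed

lemma mult_plb_class:
  "u \<in> words (plb_gens n) \<Longrightarrow> v \<in> words (plb_gens n) \<Longrightarrow>
    plb_class n u \<otimes>\<^bsub>PLB_ext n\<^esub> plb_class n v = plb_class n (u @ v)"
  unfolding PLB_ext_def by (rule mult_word_class)

lemma plb_relation:
  assumes "(u, v) \<in> plb_rels n" "u \<in> words (plb_gens n)" "v \<in> words (plb_gens n)"
  shows "plb_class n u = plb_class n v"
  using assms by (simp add: word_class_eq_iff presented_cong.relation)

lemma plb_tau_sq:
  assumes "i \<in> {1..n}"
  shows "plb_letter n (Tau i) \<otimes>\<^bsub>PLB_ext n\<^esub> plb_letter n (Tau i) = \<one>\<^bsub>PLB_ext n\<^esub>"
proof -
  have "plb_class n (\<tau> i @ \<tau> i) = plb_class n []"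
    using assms by (intro plb_relation plb_rels.tau_sq) auto
  moreover have "\<one>\<^bsub>PLB_ext n\<^esub> = plb_class n []"
    by (simp add: PLB_ext_def presented_group_def)
  ultimately show ?thesis
    using assms by (simp add: mult_plb_class)
qed

lemma plb_tau_commute:
  assumes "i \<in> {1..n}" "j \<in> {1..n}"
  shows "plb_letter n (Tau i) \<otimes>\<^bsub>PLB_ext n\<^esub> plb_letter n (Tau j) =
    plb_letter n (Tau j) \<otimes>\<^bsub>PLB_ext n\<^esub> plb_letter n (Tau i)"
proof (cases "i = j")
  case False
  then have "plb_class n (\<tau> i @ \<tau> j) = plb_class n (\<tau> j @ \<tau> i)"
    using assms by (intro plb_relation plb_rels.tau_comm) auto
  then show ?thesis
    using assms by (simp add: mult_plb_class)
qed simp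

lemma WP_eq: "WP n = generate (PLB_ext n) (plb_letter n ` alpha_gens n)"
  unfolding WP_def alpha_gens_def by (rule arg_cong[where f = "generate _"]) blast

lemma alpha_letters_closed: "plb_letter n ` alpha_gens n \<subseteq> carrier (PLB_ext n)"
  using alpha_gens_subset plb_letter_closed by blast

lemma WP_subgroup: "subgroup (WP n) (PLB_ext n)"
  unfolding WP_eq by (rule group.generate_is_subgroup[OF group_PLB_ext alpha_letters_closed])

lemma alpha_letter_in_WP: "x \<in> alpha_gens n \<Longrightarrow> plb_letter n x \<in> WP n"
  unfolding WP_eq by (intro generate.incl imageI)

text \<open>The inverse of a generator is the class of the letter with the opposite sign, so words with
  signs already give all of the subgroup generated by the \<open>\<alpha>\<^sub>i\<^sub>j\<close>.\<close>

lemma WP_word: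
  assumes "h \<in> WP n"
  obtains w where "w \<in> words (alpha_gens n)" "h = plb_class n w"
proof -
  have sub: "w \<in> words (plb_gens n)" if "w \<in> words (alpha_gens n)" for w
    using that alpha_gens_subset by (auto simp: words_def)
  have "\<exists>w\<in>words (alpha_gens n). h = plb_class n w"
    using assms unfolding WP_eq
  proof (induction rule: generate.induct)
    case one
    show ?case
      by (rule bexI[of _ "[]"]) (simp_all add: PLB_ext_def presented_group_def)
  next
    case (incl h)
    then show ?case
      by (auto intro!: bexI[of _ "[(_, True)]"])
  next
    case (inv h)
    obtain x where x: "x \<in> alpha_gens n" "h = plb_letter n x"
      using inv by auto
    then have "plb_class n [(x, False)] = inv\<^bsub>PLB_ext n\<^esub> h"
      using alpha_gens_subset plb_class_inverse_letter by blast
    then show ?case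
      using x by (intro bexI[of _ "[(x, False)]"]) simp_all
  next
    case (eng h1 h2)
    then show ?case
      using sub by (metis mult_plb_class words_simps(3))
  qed
  then show thesis
    using that by blast
qed

lemma (in group) conj_generate:
  assumes H: "H \<subseteq> carrier G" and x: "x \<in> carrier G"
    and conj: "\<And>h. h \<in> H \<Longrightarrow> x \<otimes> h \<otimes> inv x \<in> generate G H"
    and "h \<in> generate G H"
  shows "x \<otimes> h \<otimes> inv x \<in> generate G H"
  using assms(4)
proof (induction rule: generate.induct)
  case one
  then show ?case
    using x generate.one by simp
next
  case (incl h)
  then show ?case
    by (rule conj)
next
  case (inv h)
  then have "x \<otimes> inv h \<otimes> inv x = inv (x \<otimes> h \<otimes> inv x)"
    using H x by (auto simp: inv_mult_group m_assoc)
  then show ?case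
    using generate_m_inv_closed[OF H conj[OF inv]] by simp
next
  case (eng h1 h2)
  then have "h1 \<in> carrier G" "h2 \<in> carrier G"
    using generate_in_carrier[OF H] by auto
  then have "x \<otimes> (h1 \<otimes> h2) \<otimes> inv x = (x \<otimes> h1 \<otimes> inv x) \<otimes> (x \<otimes> h2 \<otimes> inv x)"
    using x by (simp add: m_assoc inv_solve_left)
  then show ?case
    using eng.IH generate.eng by metis
qed

text \<open>This is where the relations between \<open>\<tau>\<^sub>k\<close> and \<open>\<alpha>\<^sub>i\<^sub>j\<close> enter: conjugation inverts \<open>\<alpha>\<^sub>i\<^sub>j\<close> if \<open>k = j\<close>
  and fixes it otherwise.\<close>

lemma conj_tau_alpha:
  assumes x: "x \<in> alpha_gens n" and k: "k \<in> {1..n}"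
  shows "plb_letter n (Tau k) \<otimes>\<^bsub>PLB_ext n\<^esub> plb_letter n x \<otimes>\<^bsub>PLB_ext n\<^esub>
    inv\<^bsub>PLB_ext n\<^esub> plb_letter n (Tau k) \<in> WP n"
proof -
  interpret group "PLB_ext n"
    by (rule group_PLB_ext)
  obtain i j where ij: "x = Alpha i j" "i \<in> {1..n}" "j \<in> {1..n}" "i \<noteq> j"
    using x by (auto simp: alpha_gens_def)
  let ?a = "plb_letter n x" and ?t = "plb_letter n (Tau k)"
  have gens: "x \<in> plb_gens n" "Tau k \<in> plb_gens n"
    using x k alpha_gens_subset by auto
  have cl: "?a \<in> carrier (PLB_ext n)" "?t \<in> carrier (PLB_ext n)"
    using gens plb_letter_closed by auto
  have a: "?a \<in> WP n" "inv\<^bsub>PLB_ext n\<^esub> ?a \<in> WP n"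
    using alpha_letter_in_WP[OF x] subgroup.m_inv_closed[OF WP_subgroup] by auto
  show ?thesis
  proof (cases "k = j")
    case True
    have inv_t: "inv\<^bsub>PLB_ext n\<^esub> ?t = ?t"
      using plb_tau_sq[OF k] cl by (simp add: inv_equality)
    have "plb_class n (\<tau> k @ [(x, True)] @ \<tau> k) = plb_class n [(x, False)]"
      using ij gens plb_rels.tau_alpha_target[of j i n] unfolding True
      by (intro plb_relation) simp_all
    moreover have "plb_class n [(x, False)] = inv\<^bsub>PLB_ext n\<^esub> ?a"
      using gens(1) by (rule plb_class_inverse_letter)
    moreover have "plb_class n (\<tau> k @ [(x, True)] @ \<tau> k) = ?t \<otimes>\<^bsub>PLB_ext n\<^esub> ?a \<otimes>\<^bsub>PLB_ext n\<^esub> ?t"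
      using gens by (simp add: mult_plb_class)
    ultimately show ?thesis
      using a inv_t by simp
  next
    case False
    have "plb_class n (\<tau> k @ [(x, True)]) = plb_class n ([(x, True)] @ \<tau> k)"
    proof (cases "k = i")
      case True
      then show ?thesis
        using ij gens plb_rels.tau_alpha_source[of i j n] by (intro plb_relation) simp_all
    next
      case False
      then show ?thesis
        using ij k gens \<open>k \<noteq> j\<close> plb_rels.tau_alpha_disjoint[of k i j n]
        by (intro plb_relation) simp_all
    qed
    then have "?t \<otimes>\<^bsub>PLB_ext n\<^esub> ?a = ?a \<otimes>\<^bsub>PLB_ext n\<^esub> ?t"
      using gens by (simp add: mult_plb_class)
    then show ?thesis
      using cl a by (simp add: m_assoc)
  qed
qed

text \<open>Normality can be tested on conjugation by single letters and, for those, on the generators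
  \<open>\<alpha>\<^sub>i\<^sub>j\<close> of the subgroup.\<close>

lemma WP_normal: "WP n \<lhd> PLB_ext n"
proof -
  interpret group "PLB_ext n"
    by (rule group_PLB_ext)
  let ?G = "PLB_ext n"
  have W: "WP n \<subseteq> carrier ?G"
    using WP_subgroup by (rule subgroup.subset)
  have letter: "l \<otimes>\<^bsub>?G\<^esub> h \<otimes>\<^bsub>?G\<^esub> inv\<^bsub>?G\<^esub> l \<in> WP n"
    if x: "x \<in> plb_gens n" and l: "l = plb_letter n x \<or> l = inv\<^bsub>?G\<^esub> plb_letter n x"
      and h: "h \<in> WP n" for x l h
    using x
  proof (cases rule: plb_gens_cases)
    case (alpha i j)
    then have "l \<in> WP n"
      using l alpha_letter_in_WP[of x n] subgroup.m_inv_closed[OF WP_subgroup]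
      by (auto simp: alpha_gens_def)
    then show ?thesis
      using h by (intro subgroup.m_closed[OF WP_subgroup] subgroup.m_inv_closed[OF WP_subgroup])
  next
    case (tau i)
    have t: "plb_letter n (Tau i) \<in> carrier ?G"
      using plb_letter_closed[OF x] tau by simp
    \<comment> \<open>Each \<open>\<tau>\<close> is its own inverse, so only one of the two signs has to be considered.\<close>
    then have "l = plb_letter n (Tau i)"
      using l tau plb_tau_sq[of i n] by (auto simp: inv_equality)
    then show ?thesis
      using conj_generate[OF alpha_letters_closed t _ h[unfolded WP_eq]] conj_tau_alpha tau
      unfolding WP_eq[symmetric] by blast
  qed
  have "plb_class n w \<otimes>\<^bsub>?G\<^esub> h \<otimes>\<^bsub>?G\<^esub> inv\<^bsub>?G\<^esub> plb_class n w \<in> WP n"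
    if "w \<in> words (plb_gens n)" "h \<in> WP n" for w h
    using that(1)
  proof (induction w)
    case Nil
    have "plb_class n [] = \<one>\<^bsub>?G\<^esub>"
      by (simp add: PLB_ext_def presented_group_def)
    then show ?case
      using W that(2) by auto
  next
    case (Cons a w)
    obtain x b where a: "a = (x, b)" and x: "x \<in> plb_gens n" and w: "w \<in> words (plb_gens n)"
      using Cons.prems by (cases a) auto
    let ?l = "if b then plb_letter n x else inv\<^bsub>?G\<^esub> plb_letter n x"
    have aw: "plb_class n (a # w) = ?l \<otimes>\<^bsub>?G\<^esub> plb_class n w"
      using Cons.prems w a by (simp only: plb_class_eq_word_eval word_eval.simps)
    have cl: "?l \<in> carrier ?G" "plb_class n w \<in> carrier ?G" "h \<in> carrier ?G"
      using plb_letter_closed[OF x] w W that(2) by (auto simp: carrier_PLB_ext[symmetric])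
        (simp add: carrier_PLB_ext)
    have "plb_class n (a # w) \<otimes>\<^bsub>?G\<^esub> h \<otimes>\<^bsub>?G\<^esub> inv\<^bsub>?G\<^esub> plb_class n (a # w) =
        ?l \<otimes>\<^bsub>?G\<^esub> (plb_class n w \<otimes>\<^bsub>?G\<^esub> h \<otimes>\<^bsub>?G\<^esub> inv\<^bsub>?G\<^esub> plb_class n w) \<otimes>\<^bsub>?G\<^esub> inv\<^bsub>?G\<^esub> ?l"
      using cl by (simp only: aw inv_mult_group m_assoc m_closed inv_closed)
    then show ?case
      using letter[OF x _ Cons.IH[OF w], of ?l] by simp
  qed
  then show ?thesis
    using WP_subgroup by (auto simp: normal_inv_iff carrier_PLB_ext)
qed

lemma plb_class_in_normalI:
  assumes N: "N \<lhd> PLB_ext n" and w: "w \<in> words (plb_gens n)"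
    and one: "word_eval (PLB_ext n Mod N) (\<lambda>x. N #>\<^bsub>PLB_ext n\<^esub> plb_letter n x) w =
      \<one>\<^bsub>PLB_ext n Mod N\<^esub>"
  shows "plb_class n w \<in> N"
proof -
  interpret normal N "PLB_ext n"
    by (rule N)
  have "plb_letter n \<in> plb_gens n \<rightarrow> carrier (PLB_ext n)"
    using plb_letter_closed by blast
  then have "N #>\<^bsub>PLB_ext n\<^esub> plb_class n w = \<one>\<^bsub>PLB_ext n Mod N\<^esub>"
    using hom_word_eval[OF r_coset_hom_Mod factorgroup_is_group _ w, of "plb_letter n"] one
    by (simp add: plb_class_eq_word_eval[OF w] comp_def)
  then have "N #>\<^bsub>PLB_ext n\<^esub> plb_class n w = N"
    by simp
  then show ?thesis
    using rcos_self[OF _ is_subgroup, of "plb_class n w"] w by (simp add: carrier_PLB_ext)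
qed

text \<open>Modulo \<open>WP n\<close> the letters \<open>\<alpha>\<^sub>i\<^sub>j\<close> die and only the commuting involutions \<open>\<tau>\<^sub>i\<close> survive, so a word
  whose \<open>\<tau>\<close>-exponents are all even becomes trivial there.\<close>

lemma even_tau_word_in_WP:
  assumes w: "w \<in> words (plb_gens n)" and even: "\<And>i. i \<in> {1..n} \<Longrightarrow> even (exp_sum w (Tau i))"
  shows "plb_class n w \<in> WP n"
proof (rule plb_class_in_normalI[OF WP_normal w])
  interpret normal "WP n" "PLB_ext n"
    by (rule WP_normal)
  let ?G = "PLB_ext n" and ?Q = "PLB_ext n Mod WP n"
  interpret Q: group ?Q
    by (rule factorgroup_is_group)
  let ?f = "\<lambda>x. WP n #>\<^bsub>?G\<^esub> plb_letter n x"
  have mult: "?f x \<otimes>\<^bsub>?Q\<^esub> ?f y = WP n #>\<^bsub>?G\<^esub> (plb_letter n x \<otimes>\<^bsub>?G\<^esub> plb_letter n y)"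
    if "x \<in> plb_gens n" "y \<in> plb_gens n" for x y
    using that plb_letter_closed by (simp add: rcos_sum)
  have closed: "?f x \<in> carrier ?Q" if "x \<in> plb_gens n" for x
    using that plb_letter_closed by (auto simp: FactGroup_def RCOSETS_def)
  have alpha_one: "?f x = \<one>\<^bsub>?Q\<^esub>" if "x \<in> alpha_gens n" for x
    using rcos_const[OF group_PLB_ext alpha_letter_in_WP[OF that]] by simp
  have gens: "x \<in> plb_gens n" if "(x, b) \<in> set w" for x b
    using w that by (auto simp: words_iff_set)
  have commute: "?f x \<otimes>\<^bsub>?Q\<^esub> ?f y = ?f y \<otimes>\<^bsub>?Q\<^esub> ?f x"
    if x: "x \<in> plb_gens n" and y: "y \<in> plb_gens n" for x y
    using x
  proof (cases rule: plb_gens_cases)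
    case (alpha i j)
    then have "x \<in> alpha_gens n"
      by (auto simp: alpha_gens_def)
    then show ?thesis
      using closed[OF y] by (simp only: alpha_one Q.l_one Q.r_one)
  next
    case (tau i)
    note x = this
    from y show ?thesis
    proof (cases rule: plb_gens_cases)
      case (alpha k j)
      then have "y \<in> alpha_gens n"
        by (auto simp: alpha_gens_def)
      then show ?thesis
        using closed[OF \<open>x \<in> plb_gens n\<close>] by (simp only: alpha_one Q.l_one Q.r_one)
    next
      case (tau j)
      then show ?thesis
        using x that plb_tau_commute[of i n j] by (simp only: mult)
    qed
  qed
  have power: "?f x [^]\<^bsub>?Q\<^esub> exp_sum w x = \<one>\<^bsub>?Q\<^esub>" if x: "x \<in> plb_gens n" for x
    using x
  proof (cases rule: plb_gens_cases)
    case (alpha i j)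
    then have "x \<in> alpha_gens n"
      by (auto simp: alpha_gens_def)
    then show ?thesis
      by (simp only: alpha_one Q.int_pow_one)
  next
    case (tau i)
    obtain k where k: "exp_sum w x = 2 * k"
      using even[of i] tau by (auto elim: evenE)
    have "?f x [^]\<^bsub>?Q\<^esub> (2 :: int) = ?f x \<otimes>\<^bsub>?Q\<^esub> ?f x"
      using Q.int_pow_mult[OF closed[OF x], of 1 1] closed[OF x] by (simp only: Q.int_pow_1 one_add_one)
    also have "\<dots> = WP n #>\<^bsub>?G\<^esub> \<one>\<^bsub>?G\<^esub>"
      using tau x plb_tau_sq[of i n] by (simp only: mult)
    also have "\<dots> = \<one>\<^bsub>?Q\<^esub>"
      using subset by (simp add: coset_mult_one)
    finally show ?thesis
      using Q.int_pow_pow[OF closed[OF x], of 2 k] k by (simp only: Q.int_pow_one)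
  qed
  show "word_eval ?Q ?f w = \<one>\<^bsub>?Q\<^esub>"
    by (rule Q.word_eval_eq_one) (use commute power closed gens in blast)+
qed

lemma WP_commute_mod_derived:
  assumes "g \<in> WP n" "h \<in> WP n"
  shows "(derived (PLB_ext n) (WP n) #>\<^bsub>PLB_ext n\<^esub> g) \<otimes>\<^bsub>PLB_ext n Mod derived (PLB_ext n) (WP n)\<^esub>
      (derived (PLB_ext n) (WP n) #>\<^bsub>PLB_ext n\<^esub> h) =
    (derived (PLB_ext n) (WP n) #>\<^bsub>PLB_ext n\<^esub> h) \<otimes>\<^bsub>PLB_ext n Mod derived (PLB_ext n) (WP n)\<^esub>
      (derived (PLB_ext n) (WP n) #>\<^bsub>PLB_ext n\<^esub> g)"
proof -
  let ?G = "PLB_ext n" and ?N = "derived (PLB_ext n) (WP n)"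
  interpret N: normal ?N ?G
    using group.derived_is_normal[OF group_PLB_ext WP_normal] .
  have cl: "g \<in> carrier ?G" "h \<in> carrier ?G"
    using assms subgroup.subset[OF WP_subgroup] by auto
  have "g \<otimes>\<^bsub>?G\<^esub> h \<otimes>\<^bsub>?G\<^esub> inv\<^bsub>?G\<^esub> g \<otimes>\<^bsub>?G\<^esub> inv\<^bsub>?G\<^esub> h \<in> ?N"
    unfolding derived_def using assms by (intro generate.incl) blast
  then have "(g \<otimes>\<^bsub>?G\<^esub> h) \<otimes>\<^bsub>?G\<^esub> inv\<^bsub>?G\<^esub> (h \<otimes>\<^bsub>?G\<^esub> g) \<in> ?N"
    using cl by (simp add: N.inv_mult_group N.m_assoc)
  then have "?N #>\<^bsub>?G\<^esub> (g \<otimes>\<^bsub>?G\<^esub> h) = ?N #>\<^bsub>?G\<^esub> (h \<otimes>\<^bsub>?G\<^esub> g)"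
    using cl by (intro N.repr_independence[symmetric] N.rcos_module_rev N.is_subgroup
        group_PLB_ext N.m_closed)
  then show ?thesis
    using cl by (simp add: N.rcos_sum)
qed

text \<open>Modulo \<open>\<Gamma>\<^sub>2(WP n)\<close> the letters \<open>\<alpha>\<^sub>i\<^sub>j\<close> commute, so the value of a word in them is determined
  by its exponent sums.\<close>

lemma balanced_alpha_word_in_derived:
  assumes w: "w \<in> words (alpha_gens n)" and sum: "\<And>x. x \<in> alpha_gens n \<Longrightarrow> exp_sum w x = 0"
  shows "plb_class n w \<in> derived (PLB_ext n) (WP n)"
proof -
  let ?G = "PLB_ext n" and ?N = "derived (PLB_ext n) (WP n)"
  interpret N: normal ?N ?G
    using group.derived_is_normal[OF group_PLB_ext WP_normal] .
  interpret Q: group "?G Mod ?N"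
    by (rule N.factorgroup_is_group)
  have gens: "x \<in> alpha_gens n" if "(x, b) \<in> set w" for x b
    using w that by (auto simp: words_iff_set)
  have closed: "?N #>\<^bsub>?G\<^esub> plb_letter n x \<in> carrier (?G Mod ?N)" if "x \<in> alpha_gens n" for x
    using that alpha_letters_closed by (auto simp: FactGroup_def RCOSETS_def)
  show ?thesis
  proof (rule plb_class_in_normalI)
    show "?N \<lhd> ?G"
      by (rule N.normal_axioms)
    show "w \<in> words (plb_gens n)"
      using w alpha_gens_subset by (auto simp: words_def)
    show "word_eval (?G Mod ?N) (\<lambda>x. ?N #>\<^bsub>?G\<^esub> plb_letter n x) w = \<one>\<^bsub>?G Mod ?N\<^esub>"
    proof (rule Q.word_eval_eq_one)
      fix x b assume x: "(x, b) \<in> set w"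
      show "?N #>\<^bsub>?G\<^esub> plb_letter n x \<in> carrier (?G Mod ?N) \<and>
          (?N #>\<^bsub>?G\<^esub> plb_letter n x) [^]\<^bsub>?G Mod ?N\<^esub> exp_sum w x = \<one>\<^bsub>?G Mod ?N\<^esub>"
        using closed[OF gens[OF x]] sum[OF gens[OF x]] by (simp only: int_pow_0 simp_thms)
      fix y c assume y: "(y, c) \<in> set w"
      show "(?N #>\<^bsub>?G\<^esub> plb_letter n x) \<otimes>\<^bsub>?G Mod ?N\<^esub> (?N #>\<^bsub>?G\<^esub> plb_letter n y) =
          (?N #>\<^bsub>?G\<^esub> plb_letter n y) \<otimes>\<^bsub>?G Mod ?N\<^esub> (?N #>\<^bsub>?G\<^esub> plb_letter n x)"
        by (intro WP_commute_mod_derived alpha_letter_in_WP gens[OF x] gens[OF y])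
    qed
  qed
qed

section \<open>The representation by sign changes\<close>

definition index_pairs :: "nat \<Rightarrow> (nat \<times> nat) set" where
  "index_pairs n = {(i, j). i \<in> {1..n} \<and> j \<in> {1..n} \<and> i \<noteq> j}"

lemma card_index_pairs: "card (index_pairs n) = n * (n - 1)"
proof -
  have eq: "index_pairs n = Sigma {1..n} (\<lambda>i. {1..n} - {i})"
    by (auto simp: index_pairs_def)
  have "card (index_pairs n) = (\<Sum>i\<in>{1..n}. card ({1..n} - {i}))"
    unfolding eq by (rule card_SigmaI) auto
  also have "\<dots> = (\<Sum>i\<in>{1..n}. n - 1)"
    by (rule sum.cong) auto
  finally show ?thesis
    by simp
qed

lemma Z2_pow_cases:
  assumes "\<epsilon> \<in> carrier (Z2_pow n)" "j \<in> {1..n}"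
  obtains "\<epsilon> j = 0" | "\<epsilon> j = 1"
proof -
  have "\<epsilon> j \<in> {0..<2}"
    using assms by (auto simp: PiE_iff carrier_integer_mod_group)
  then show thesis
    using that by force
qed

text \<open>The diagonal action: \<open>\<epsilon>\<close> multiplies the coordinate \<open>k\<close> by \<open>(- 1)\<close> to the power \<open>\<epsilon> (t k)\<close>. The
  outer restriction makes the map extensional, as membership in the automorphism group requires.\<close>

definition sign_rep :: "nat \<Rightarrow> (nat \<Rightarrow> nat) \<Rightarrow> (nat \<Rightarrow> int) \<Rightarrow> (nat \<Rightarrow> int) \<Rightarrow> nat \<Rightarrow> int" where
  "sign_rep m t \<epsilon> = (\<lambda>z\<in>carrier (Z_pow m). \<lambda>k\<in>{1..m}. if \<epsilon> (t k) = 0 then z k else - z k)"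

lemma sign_rep_hom:
  assumes t: "t ` {1..m} \<subseteq> {1..n}"
  shows "sign_rep m t \<in> hom (Z2_pow n) (AutoGroup (Z_pow m))"
proof (rule homI)
  have closed: "sign_rep m t \<epsilon> z \<in> carrier (Z_pow m)" if "z \<in> carrier (Z_pow m)" for \<epsilon> z
    using that by (auto simp: sign_rep_def)
  have invol: "sign_rep m t \<epsilon> (sign_rep m t \<epsilon> z) = z" if z: "z \<in> carrier (Z_pow m)" for \<epsilon> z
    using closed[OF z] z by (auto simp: sign_rep_def fun_eq_iff PiE_iff extensional_def)
  have ext: "sign_rep m t \<epsilon> \<in> extensional (carrier (Z_pow m))" for \<epsilon>
    by (simp add: sign_rep_def)
  have auto: "sign_rep m t \<epsilon> \<in> auto (Z_pow m)" for \<epsilon>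
  proof -
    have "sign_rep m t \<epsilon> \<in> hom (Z_pow m) (Z_pow m)"
      by (rule homI) (use closed in \<open>auto simp: sign_rep_def fun_eq_iff\<close>)
    moreover have "bij_betw (sign_rep m t \<epsilon>) (carrier (Z_pow m)) (carrier (Z_pow m))"
      by (rule bij_betw_byWitness[where f' = "sign_rep m t \<epsilon>"]) (use closed invol in blast)+
    ultimately show ?thesis
      using ext by (simp add: auto_def Bij_def)
  qed
  show "sign_rep m t \<epsilon> \<in> carrier (AutoGroup (Z_pow m))" for \<epsilon>
    using auto by (simp add: AutoGroup_def)
  fix \<epsilon> \<delta> assume eps: "\<epsilon> \<in> carrier (Z2_pow n)" and del: "\<delta> \<in> carrier (Z2_pow n)"
  have sum: "(\<epsilon> \<otimes>\<^bsub>Z2_pow n\<^esub> \<delta>) (t k) = (if \<epsilon> (t k) = \<delta> (t k) then 0 else 1)"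
    and other: "\<epsilon> (t k) \<noteq> \<delta> (t k) \<Longrightarrow> \<epsilon> (t k) = 0 \<longleftrightarrow> \<delta> (t k) \<noteq> 0" if "k \<in> {1..m}" for k
  proof -
    have k: "t k \<in> {1..n}"
      using t that by blast
    show "(\<epsilon> \<otimes>\<^bsub>Z2_pow n\<^esub> \<delta>) (t k) = (if \<epsilon> (t k) = \<delta> (t k) then 0 else 1)"
      using k by (cases rule: Z2_pow_cases[OF eps k]; cases rule: Z2_pow_cases[OF del k]) simp_all
    show "\<epsilon> (t k) = 0 \<longleftrightarrow> \<delta> (t k) \<noteq> 0" if "\<epsilon> (t k) \<noteq> \<delta> (t k)"
      using that by (cases rule: Z2_pow_cases[OF eps k]; cases rule: Z2_pow_cases[OF del k]) simp_all
  qed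
  have "sign_rep m t (\<epsilon> \<otimes>\<^bsub>Z2_pow n\<^esub> \<delta>) z = sign_rep m t \<epsilon> (sign_rep m t \<delta> z)"
    if z: "z \<in> carrier (Z_pow m)" for z
  proof
    fix k
    show "sign_rep m t (\<epsilon> \<otimes>\<^bsub>Z2_pow n\<^esub> \<delta>) z k = sign_rep m t \<epsilon> (sign_rep m t \<delta> z) k"
      using sum[of k] other[of k] z closed[OF z]
      by (auto simp: sign_rep_def simp del: mult_product_group)
  qed
  then have "sign_rep m t (\<epsilon> \<otimes>\<^bsub>Z2_pow n\<^esub> \<delta>) =
      compose (carrier (Z_pow m)) (sign_rep m t \<epsilon>) (sign_rep m t \<delta>)"
    by (intro extensionalityI[OF ext compose_extensional]) (simp only: compose_eq)
  then show "sign_rep m t (\<epsilon> \<otimes>\<^bsub>Z2_pow n\<^esub> \<delta>) =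
      sign_rep m t \<epsilon> \<otimes>\<^bsub>AutoGroup (Z_pow m)\<^esub> sign_rep m t \<delta>"
    using auto by (simp add: AutoGroup_def BijGroup_def auto_def del: mult_product_group carrier_product_group)
qed

text \<open>Every \<open>j\<close> governs the sign of some coordinate, so \<open>\<epsilon> j\<close> can be recovered from the action.\<close>

lemma sign_rep_inj:
  assumes t: "t ` {1..m} = {1..n}"
  shows "inj_on (sign_rep m t) (carrier (Z2_pow n))"
proof (rule inj_onI)
  fix \<epsilon> \<delta>
  assume eps: "\<epsilon> \<in> carrier (Z2_pow n)" and del: "\<delta> \<in> carrier (Z2_pow n)"
    and eq: "sign_rep m t \<epsilon> = sign_rep m t \<delta>"
  show "\<epsilon> = \<delta>"
  proof (rule extensionalityI)
    show "\<epsilon> \<in> extensional {1..n}" "\<delta> \<in> extensional {1..n}"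
      using eps del by (auto simp: PiE_iff)
    fix j assume j: "j \<in> {1..n}"
    then have "j \<in> t ` {1..m}"
      by (simp only: t)
    then obtain k where k: "k \<in> {1..m}" "t k = j"
      by (rule imageE) simp
    \<comment> \<open>On the all-ones vector the sign of coordinate \<open>k\<close> is visible.\<close>
    have "sign_rep m t \<epsilon> (\<lambda>k\<in>{1..m}. 1) k = sign_rep m t \<delta> (\<lambda>k\<in>{1..m}. 1) k"
      using eq by simp
    then have "\<epsilon> j = 0 \<longleftrightarrow> \<delta> j = 0"
      using k by (simp add: sign_rep_def split: if_splits)
    then show "\<epsilon> j = \<delta> j"
      by (cases rule: Z2_pow_cases[OF eps j]; cases rule: Z2_pow_cases[OF del j]) simp_all
  qed
qed

section \<open>A representation of the pure extended loop braid group\<close>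

text \<open>The coordinates of the lattice are the ordered pairs of distinct indices, and the locale fixes
  an arbitrary numbering of them, since \<open>\<int>\<^sup>m\<close> is indexed by \<open>{1..m}\<close>.\<close>

locale index_pair_numbering =
  fixes n m :: nat and idx :: "nat \<times> nat \<Rightarrow> nat"
  assumes idx: "bij_betw idx (index_pairs n) {1..m}"
begin

text \<open>\<open>\<tau>\<^sub>k\<close> inverts exactly the \<open>\<alpha>\<^sub>i\<^sub>j\<close> with \<open>j = k\<close>, hence signs are governed by second components.\<close>

definition target :: "nat \<Rightarrow> nat" where
  "target k = snd (inv_into (index_pairs n) idx k)"

lemma target_idx: "(i, j) \<in> index_pairs n \<Longrightarrow> target (idx (i, j)) = j"
  using idx by (simp add: target_def bij_betw_inv_into_left)

lemma target_in: "target ` {1..m} \<subseteq> {1..n}"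
proof
  fix j assume "j \<in> target ` {1..m}"
  then obtain k where k: "k \<in> {1..m}" "j = target k"
    by auto
  then have "inv_into (index_pairs n) idx k \<in> index_pairs n"
    using idx by (metis bij_betw_def inv_into_into)
  then show "j \<in> {1..n}"
    using k by (auto simp: target_def index_pairs_def)
qed

text \<open>With a single index there are no pairs and \<open>\<tau>\<^sub>1\<close> acts trivially; from two indices on, every
  index is the second component of some pair.\<close>

lemma target_onto:
  assumes "n \<ge> 2"
  shows "target ` {1..m} = {1..n}"
proof
  show "{1..n} \<subseteq> target ` {1..m}"
  proof
    fix j assume j: "j \<in> {1..n}"
    define i :: nat where "i = (if j = 1 then 2 else 1)"
    have ij: "(i, j) \<in> index_pairs n"
      using j assms by (auto simp: index_pairs_def i_def)
    then have "idx (i, j) \<in> {1..m}"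
      using idx by (metis bij_betw_def imageI)
    then show "j \<in> target ` {1..m}"
      using target_idx[OF ij] by (metis imageI)
  qed
qed (rule target_in)

abbreviation "E \<equiv> semidirect_product (Z_pow m) (Z2_pow n) (sign_rep m target)"

sublocale Z: comm_group "Z_pow m"
  by (rule comm_group_Z_pow)

sublocale action: group_action_by_auto "Z_pow m" "Z2_pow n" "sign_rep m target"
  using sign_rep_hom[OF target_in]
  by (simp add: group_action_by_auto_def group_action_by_auto_axioms_def Z.group_axioms)

sublocale E: group E
  by (rule action.group_semidirect_product)

abbreviation "unit k \<equiv> single {1..m} (\<lambda>_. integer_group) k 1"
abbreviation "flip i \<equiv> single {1..n} (\<lambda>_. integer_mod_group 2) i 1"

lemma unit_closed: "unit k \<in> carrier (Z_pow m)"
  by (auto simp: single_def)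

lemma flip_closed: "flip i \<in> carrier (Z2_pow n)"
  by (auto simp: single_def)

lemma flip_flip: "flip i \<otimes>\<^bsub>Z2_pow n\<^esub> flip i = \<one>\<^bsub>Z2_pow n\<^esub>"
  by (auto simp: single_def fun_eq_iff)

lemma flip_commute: "flip i \<otimes>\<^bsub>Z2_pow n\<^esub> flip j = flip j \<otimes>\<^bsub>Z2_pow n\<^esub> flip i"
  by (auto simp: single_def fun_eq_iff add.commute)

lemma sign_rep_flip_unit:
  assumes "(j, k) \<in> index_pairs n" "i \<in> {1..n}"
  shows "sign_rep m target (flip i) (unit (idx (j, k))) =
    (if i = k then inv\<^bsub>Z_pow m\<^esub> unit (idx (j, k)) else unit (idx (j, k)))"
proof -
  have "k \<in> {1..n}"
    using assms by (simp add: index_pairs_def)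
  moreover have "target l \<in> {1..n}" if "l \<in> {1..m}" for l
    using that target_in by blast
  ultimately show ?thesis
    using target_idx[OF assms(1)] assms(2) unit_closed[of "idx (j, k)"]
    by (auto simp: sign_rep_def single_def fun_eq_iff)
qed

fun rep_gen :: "plb_gen \<Rightarrow> (nat \<Rightarrow> int) \<times> (nat \<Rightarrow> int)" where
  "rep_gen (Alpha i j) = (unit (idx (i, j)), \<one>\<^bsub>Z2_pow n\<^esub>)"
| "rep_gen (Tau i) = (\<one>\<^bsub>Z_pow m\<^esub>, flip i)"

lemma rep_gen_closed: "rep_gen \<in> plb_gens n \<rightarrow> carrier E"
proof
  fix x
  show "rep_gen x \<in> carrier E"
    using unit_closed flip_closed Z.one_closed action.Q.one_closed
    by (cases x) (simp_all only: rep_gen.simps semidirect_product_simps mem_Sigma_iff)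
qed

lemma lattice_mult:
  assumes "z \<in> carrier (Z_pow m)" "w \<in> carrier (Z_pow m)"
  shows "(z, \<one>\<^bsub>Z2_pow n\<^esub>) \<otimes>\<^bsub>E\<^esub> (w, \<one>\<^bsub>Z2_pow n\<^esub>) = (z \<otimes>\<^bsub>Z_pow m\<^esub> w, \<one>\<^bsub>Z2_pow n\<^esub>)"
  using assms by (simp only: semidirect_product_simps action.rho_one action.Q.l_one action.Q.one_closed)

lemma rep_gen_alpha_commute:
  "rep_gen (Alpha i j) \<otimes>\<^bsub>E\<^esub> rep_gen (Alpha k l) = rep_gen (Alpha k l) \<otimes>\<^bsub>E\<^esub> rep_gen (Alpha i j)"
  by (simp only: rep_gen.simps lattice_mult unit_closed Z.m_comm[of "unit (idx (i, j))"])

lemma lattice_inv: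
  assumes "z \<in> carrier (Z_pow m)"
  shows "inv\<^bsub>E\<^esub> (z, \<one>\<^bsub>Z2_pow n\<^esub>) = (inv\<^bsub>Z_pow m\<^esub> z, \<one>\<^bsub>Z2_pow n\<^esub>)"
  by (rule E.inv_equality)
    (simp_all only: lattice_mult assms Z.inv_closed Z.l_inv semidirect_product_simps mem_Sigma_iff
      action.Q.one_closed action.Q.l_one action.rho_one simp_thms)

lemma rep_gen_tau_alpha:
  assumes "(j, k) \<in> index_pairs n" "i \<in> {1..n}"
  shows "rep_gen (Tau i) \<otimes>\<^bsub>E\<^esub> rep_gen (Alpha j k) =
    (if i = k then inv\<^bsub>E\<^esub> rep_gen (Alpha j k) else rep_gen (Alpha j k)) \<otimes>\<^bsub>E\<^esub> rep_gen (Tau i)"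
proof -
  let ?u = "unit (idx (j, k))"
  have inv_u: "inv\<^bsub>Z_pow m\<^esub> ?u \<in> carrier (Z_pow m)"
    using unit_closed by (rule Z.inv_closed)
  have "inv\<^bsub>E\<^esub> (?u, \<one>\<^bsub>Z2_pow n\<^esub>) = (inv\<^bsub>Z_pow m\<^esub> ?u, \<one>\<^bsub>Z2_pow n\<^esub>)"
    using unit_closed by (rule lattice_inv)
  moreover have "(z, \<one>\<^bsub>Z2_pow n\<^esub>) \<otimes>\<^bsub>E\<^esub> rep_gen (Tau i) = (z, flip i)" if "z \<in> carrier (Z_pow m)" for z
    using that by (simp only: rep_gen.simps semidirect_product_simps action.rho_one Z.one_closed
        Z.r_one action.Q.l_one flip_closed)
  moreover have "rep_gen (Tau i) \<otimes>\<^bsub>E\<^esub> rep_gen (Alpha j k) =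
      (if i = k then inv\<^bsub>Z_pow m\<^esub> ?u else ?u, flip i)"
    using inv_u unit_closed[of "idx (j, k)"]
    by (simp only: rep_gen.simps semidirect_product_simps sign_rep_flip_unit[OF assms]
        Z.l_one action.Q.r_one flip_closed split: if_split) simp
  ultimately show ?thesis
    using inv_u unit_closed by (simp only: rep_gen.simps split: if_split) metis
qed

lemma rep_gen_tau_tau:
  "rep_gen (Tau i) \<otimes>\<^bsub>E\<^esub> rep_gen (Tau j) = (\<one>\<^bsub>Z_pow m\<^esub>, flip i \<otimes>\<^bsub>Z2_pow n\<^esub> flip j)"
  by (simp only: rep_gen.simps semidirect_product_simps action.rho_fixes_one flip_closed Z.l_one
      Z.one_closed)

lemma rep_gen_tau_sq: "rep_gen (Tau i) \<otimes>\<^bsub>E\<^esub> rep_gen (Tau i) = \<one>\<^bsub>E\<^esub>"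
  by (simp only: rep_gen_tau_tau flip_flip semidirect_product_simps)

text \<open>The relations among the \<open>\<alpha>\<^sub>i\<^sub>j\<close> hold because their images lie in the lattice, those among the
  \<open>\<tau>\<^sub>i\<close> because their images lie in the complement; the mixed ones say that the action of \<open>\<tau>\<^sub>i\<close>
  is the change of signs.\<close>

lemma rep_gen_relations:
  assumes "(u, v) \<in> plb_rels n"
  shows "word_eval E rep_gen u = word_eval E rep_gen v"
proof -
  have cl: "rep_gen x \<in> carrier E" if "x \<in> plb_gens n" for x
    using that rep_gen_closed by blast
  have a: "rep_gen (Alpha i j) \<in> carrier E" if "{i, j} \<subseteq> {1..n}" "i \<noteq> j" for i j
    using that by (intro cl) (auto simp: plb_gens_def)
  have t: "rep_gen (Tau i) \<in> carrier E" if "i \<in> {1..n}" for i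
    using that by (intro cl) (auto simp: plb_gens_def)
  note [simp del] = rep_gen.simps semidirect_product_simps One_nat_def
  from assms show ?thesis
  proof cases
    case (alpha_comm i j k l)
    then show ?thesis
      using a[of i j] a[of k l] rep_gen_alpha_commute by simp
  next
    case (alpha_comm_target i j k)
    then show ?thesis
      using a[of i j] a[of k j] rep_gen_alpha_commute by simp
  next
    case (alpha_mixed i j k)
    let ?x = "rep_gen (Alpha i j)" and ?y = "rep_gen (Alpha k j)" and ?z = "rep_gen (Alpha i k)"
    have cl: "?x \<in> carrier E" "?y \<in> carrier E" "?z \<in> carrier E"
      using alpha_mixed a by simp_all
    have "?x \<otimes>\<^bsub>E\<^esub> (?y \<otimes>\<^bsub>E\<^esub> ?z) = ?z \<otimes>\<^bsub>E\<^esub> (?x \<otimes>\<^bsub>E\<^esub> ?y)"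
      using cl by (metis E.m_assoc rep_gen_alpha_commute)
    then show ?thesis
      using alpha_mixed cl by simp
  next
    case (tau_sq i)
    then show ?thesis
      using t[of i] rep_gen_tau_sq[of i] by simp
  next
    case (tau_comm i j)
    then show ?thesis
      using t[of i] t[of j] rep_gen_tau_tau[of i j] rep_gen_tau_tau[of j i] flip_commute[of i j]
      by (simp del: mult_product_group one_product_group)
  next
    case (tau_alpha_source i j)
    then show ?thesis
      using t[of i] a[of i j] rep_gen_tau_alpha[of i j i] by (simp add: index_pairs_def)
  next
    case (tau_alpha_disjoint i j k)
    then show ?thesis
      using t[of i] a[of j k] rep_gen_tau_alpha[of j k i] by (simp add: index_pairs_def)
  next
    case (tau_alpha_target i j)
    let ?a = "rep_gen (Alpha j i)" and ?t = "rep_gen (Tau i)"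
    have cl: "?a \<in> carrier E" "?t \<in> carrier E"
      using tau_alpha_target a t by simp_all
    have "?t \<otimes>\<^bsub>E\<^esub> ?a = inv\<^bsub>E\<^esub> ?a \<otimes>\<^bsub>E\<^esub> ?t"
      using tau_alpha_target rep_gen_tau_alpha[of j i i] by (simp add: index_pairs_def)
    then have "?t \<otimes>\<^bsub>E\<^esub> (?a \<otimes>\<^bsub>E\<^esub> ?t) = inv\<^bsub>E\<^esub> ?a"
      using cl rep_gen_tau_sq[of i] by (metis E.inv_closed E.m_assoc E.r_one)
    then show ?thesis
      using tau_alpha_target cl by simp
  qed
qed

end

section \<open>The quotient by the commutator subgroup of the pure welded braid group\<close>

context index_pair_numbering
begin

text \<open>The two coordinates of the image of a word are exponent counts: the second one records the
  parities of the exponents of the \<open>\<tau>\<^sub>i\<close> for every word, while the first one records the exponents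
  of the \<open>\<alpha>\<^sub>i\<^sub>j\<close> for words in the \<open>\<alpha>\<^sub>i\<^sub>j\<close> only, where no sign change interferes.\<close>

lemma snd_word_eval_rep_gen:
  assumes "w \<in> words (plb_gens n)"
  shows "snd (word_eval E rep_gen w) = (\<lambda>i\<in>{1..n}. exp_sum w (Tau i) mod 2)"
proof -
  let ?Q = "Z2_pow n"
  have "snd \<in> hom E ?Q"
    by (rule homI) auto
  then have "snd (word_eval E rep_gen w) = word_eval ?Q (snd \<circ> rep_gen) w"
    using E.hom_word_eval[OF _ action.Q.group_axioms rep_gen_closed assms] by blast
  also have "\<dots> = (\<lambda>i\<in>{1..n}. exp_sum w (Tau i) mod 2)"
    using assms
  proof (induction w)
    case Nil
    show ?case
      by simp
  next
    case (Cons a w)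
    obtain x b where a: "a = (x, b)" and x: "x \<in> plb_gens n" and w: "w \<in> words (plb_gens n)"
      using Cons.prems by (cases a) auto
    let ?q = "(snd \<circ> rep_gen) x"
    have inv: "inv\<^bsub>?Q\<^esub> ?q = ?q"
    proof (cases x)
      case (Tau i)
      then show ?thesis
        using action.Q.inv_equality[OF flip_flip flip_closed flip_closed] by (simp only: comp_apply rep_gen.simps snd_conv)
    qed (simp only: comp_apply rep_gen.simps snd_conv action.Q.inv_one)
    have "word_eval ?Q (snd \<circ> rep_gen) (a # w) =
        ?q \<otimes>\<^bsub>?Q\<^esub> (\<lambda>i\<in>{1..n}. exp_sum w (Tau i) mod 2)"
      using a Cons.IH[OF w] inv by (simp only: word_eval.simps if_cancel)
    also have "\<dots> = (\<lambda>i\<in>{1..n}. exp_sum (a # w) (Tau i) mod 2)"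
    proof (cases x)
      case (Tau i)
      have "(1 + k mod 2) mod 2 = (1 + k) mod 2" "(1 + k mod 2) mod 2 = (k - 1) mod 2" for k :: int
        by presburger+
      then show ?thesis
        using Tau a by (auto simp: fun_eq_iff single_def)
    qed (use a in \<open>auto simp: fun_eq_iff\<close>)
    finally show ?case .
  qed
  finally show ?thesis .
qed

lemma word_eval_rep_gen_alpha:
  assumes "w \<in> words (alpha_gens n)"
  shows "word_eval E rep_gen w =
    (\<lambda>k\<in>{1..m}. exp_sum w (case_prod Alpha (inv_into (index_pairs n) idx k)), \<one>\<^bsub>Z2_pow n\<^esub>)"
  using assms
proof (induction w)
  case Nil
  show ?case
    by (simp add: fun_eq_iff)
next
  case (Cons a w)
  let ?p = "inv_into (index_pairs n) idx" and ?Z = "Z_pow m" and ?o = "\<one>\<^bsub>Z2_pow n\<^esub>"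
  let ?v = "\<lambda>w. \<lambda>k\<in>{1..m}. exp_sum w (case_prod Alpha (?p k))"
  obtain i j b where a: "a = (Alpha i j, b)" and ij: "(i, j) \<in> index_pairs n"
      and w: "w \<in> words (alpha_gens n)"
    using Cons.prems by (cases a) (auto simp: alpha_gens_def index_pairs_def)
  let ?u = "unit (idx (i, j))"
  have v: "?v w \<in> carrier ?Z"
    by simp
  have eq: "case_prod Alpha (?p k) = Alpha i j \<longleftrightarrow> k = idx (i, j)" if "k \<in> {1..m}" for k
  proof -
    have "case_prod Alpha (?p k) = Alpha i j \<longleftrightarrow> ?p k = (i, j)"
      by (cases "?p k") simp
    also have "\<dots> \<longleftrightarrow> k = idx (i, j)"
      using idx ij that by (metis bij_betw_inv_into_left bij_betw_inv_into_right)
    finally show ?thesis .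
  qed
  have "word_eval E rep_gen (a # w) =
      (if b then (?u, ?o) else inv\<^bsub>E\<^esub> (?u, ?o)) \<otimes>\<^bsub>E\<^esub> (?v w, ?o)"
    using a Cons.IH[OF w] by (simp only: word_eval.simps rep_gen.simps)
  also have "\<dots> = ((if b then ?u else inv\<^bsub>?Z\<^esub> ?u) \<otimes>\<^bsub>?Z\<^esub> ?v w, ?o)"
    by (cases b) (simp_all only: if_True if_False lattice_inv[OF unit_closed]
      lattice_mult[OF unit_closed v] lattice_mult[OF Z.inv_closed[OF unit_closed] v])
  also have "(if b then ?u else inv\<^bsub>?Z\<^esub> ?u) \<otimes>\<^bsub>?Z\<^esub> ?v w = ?v (a # w)"
  proof
    fix k
    show "((if b then ?u else inv\<^bsub>?Z\<^esub> ?u) \<otimes>\<^bsub>?Z\<^esub> ?v w) k = ?v (a # w) k"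
      using unit_closed[of "idx (i, j)"] eq[of k] a by (auto simp: single_def)
  qed
  finally show ?case .
qed

text \<open>The commutator subgroup is killed because \<open>WP n\<close> lands in the abelian lattice. Conversely, if \<open>g\<close> is
  killed, then its \<open>\<tau>\<close>-exponents are even, so it lies in \<open>WP n\<close> and is represented by a word in the
  \<open>\<alpha>\<^sub>i\<^sub>j\<close>; the exponent sums of this second word vanish as well, so it is trivial modulo commutators.\<close>

lemma kernel_rep:
  assumes \<theta>: "\<theta> \<in> hom (PLB_ext n) E"
    and eval: "\<And>w. w \<in> words (plb_gens n) \<Longrightarrow> \<theta> (plb_class n w) = word_eval E rep_gen w"
  shows "kernel (PLB_ext n) E \<theta> = derived (PLB_ext n) (WP n)"
proof
  interpret \<theta>: group_hom "PLB_ext n" E \<theta>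
    by (intro group_hom.intro group_hom_axioms.intro group_PLB_ext E.group_axioms \<theta>)
  have sub: "w \<in> words (plb_gens n)" if "w \<in> words (alpha_gens n)" for w
    using that alpha_gens_subset by (auto simp: words_def)
  have W: "WP n \<subseteq> carrier (PLB_ext n)"
    using WP_subgroup by (rule subgroup.subset)
  have lattice: "\<exists>z\<in>carrier (Z_pow m). \<theta> h = (z, \<one>\<^bsub>Z2_pow n\<^esub>)" if h: "h \<in> WP n" for h
  proof -
    obtain w where w: "w \<in> words (alpha_gens n)" "h = plb_class n w"
      using h by (rule WP_word)
    then have "\<theta> h = (\<lambda>k\<in>{1..m}. exp_sum w (case_prod Alpha (inv_into (index_pairs n) idx k)),
        \<one>\<^bsub>Z2_pow n\<^esub>)"
      using eval sub word_eval_rep_gen_alpha by (simp only:)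
    then show ?thesis
      by (intro bexI) auto
  qed
  have commutator: "g \<otimes>\<^bsub>PLB_ext n\<^esub> h \<otimes>\<^bsub>PLB_ext n\<^esub> inv\<^bsub>PLB_ext n\<^esub> g \<otimes>\<^bsub>PLB_ext n\<^esub> inv\<^bsub>PLB_ext n\<^esub> h
      \<in> kernel (PLB_ext n) E \<theta>" if gh: "g \<in> WP n" "h \<in> WP n" for g h
  proof -
    have cl: "g \<in> carrier (PLB_ext n)" "h \<in> carrier (PLB_ext n)"
      using gh W by auto
    obtain y z where yz: "y \<in> carrier (Z_pow m)" "\<theta> g = (y, \<one>\<^bsub>Z2_pow n\<^esub>)"
        "z \<in> carrier (Z_pow m)" "\<theta> h = (z, \<one>\<^bsub>Z2_pow n\<^esub>)"
      using lattice gh by blast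
    have "\<theta> g \<otimes>\<^bsub>E\<^esub> \<theta> h = \<theta> h \<otimes>\<^bsub>E\<^esub> \<theta> g"
      unfolding yz(2,4) by (simp only: lattice_mult yz(1,3) Z.m_comm[of y z])
    moreover have "\<theta> g \<in> carrier E" "\<theta> h \<in> carrier E"
      using cl by (simp_all only: \<theta>.hom_closed)
    ultimately have "\<theta> g \<otimes>\<^bsub>E\<^esub> \<theta> h \<otimes>\<^bsub>E\<^esub> inv\<^bsub>E\<^esub> \<theta> g \<otimes>\<^bsub>E\<^esub> inv\<^bsub>E\<^esub> \<theta> h = \<one>\<^bsub>E\<^esub>"
      by (metis E.inv_solve_right E.m_closed E.r_inv)
    then show ?thesis
      unfolding kernel_def using cl
      by (simp only: mem_Collect_eq \<theta>.hom_mult \<theta>.hom_inv \<theta>.G.m_closed \<theta>.G.inv_closed simp_thms)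
  qed
  show "derived (PLB_ext n) (WP n) \<subseteq> kernel (PLB_ext n) E \<theta>"
    unfolding derived_def
    by (rule \<theta>.G.generate_subgroup_incl[OF _ \<theta>.subgroup_kernel]) (use commutator in blast)
  show "kernel (PLB_ext n) E \<theta> \<subseteq> derived (PLB_ext n) (WP n)"
  proof
    fix g assume "g \<in> kernel (PLB_ext n) E \<theta>"
    then have g: "g \<in> carrier (PLB_ext n)" "\<theta> g = \<one>\<^bsub>E\<^esub>"
      by (simp_all only: kernel_def mem_Collect_eq)
    obtain u where u: "u \<in> words (plb_gens n)" "g = plb_class n u"
      using g(1) by (auto simp: carrier_PLB_ext)
    \<comment> \<open>The second coordinate puts \<open>g\<close> into \<open>WP n\<close>. The first is evaluated on a new word \<open>w\<close> for \<open>g\<close>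
      that contains no \<open>\<tau>\<close>; on \<open>u\<close> it would involve signs.\<close>
    have "snd (word_eval E rep_gen u) = \<one>\<^bsub>Z2_pow n\<^esub>"
      using g eval u by (simp only: semidirect_product_simps snd_conv)
    then have "exp_sum u (Tau i) mod 2 = 0" if "i \<in> {1..n}" for i
      using that snd_word_eval_rep_gen[OF u(1)] by (auto dest: fun_cong[where x = i])
    then have "g \<in> WP n"
      using even_tau_word_in_WP[OF u(1)] u(2) by (simp add: even_iff_mod_2_eq_zero)
    then obtain w where w: "w \<in> words (alpha_gens n)" "g = plb_class n w"
      by (rule WP_word)
    have "fst (word_eval E rep_gen w) = \<one>\<^bsub>Z_pow m\<^esub>"
      using g eval w sub by (simp only: semidirect_product_simps fst_conv)
    then have zero: "exp_sum w (case_prod Alpha (inv_into (index_pairs n) idx k)) = 0"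
      if "k \<in> {1..m}" for k
      using that word_eval_rep_gen_alpha[OF w(1)] by (auto dest: fun_cong[where x = k])
    have "exp_sum w x = 0" if x_in: "x \<in> alpha_gens n" for x
    proof -
      obtain i j where x: "x = Alpha i j" and ij: "(i, j) \<in> index_pairs n"
        using x_in by (auto simp: alpha_gens_def index_pairs_def)
      then have "idx (i, j) \<in> {1..m}"
        using idx by (metis bij_betw_def imageI)
      then show ?thesis
        using zero[of "idx (i, j)"] idx ij x by (simp add: bij_betw_inv_into_left)
    qed
    then show "g \<in> derived (PLB_ext n) (WP n)"
      unfolding w(2) by (rule balanced_alpha_word_in_derived[OF w(1)])
  qed
qed

text \<open>The basis vectors and the sign changes are images of generators, and their powers generate the
  lattice and its complement.\<close>

lemma rep_onto:
  assumes \<theta>: "\<theta> \<in> hom (PLB_ext n) E"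
    and eval: "\<And>w. w \<in> words (plb_gens n) \<Longrightarrow> \<theta> (plb_class n w) = word_eval E rep_gen w"
  shows "\<theta> ` carrier (PLB_ext n) = carrier E"
proof
  interpret \<theta>: group_hom "PLB_ext n" E \<theta>
    by (intro group_hom.intro group_hom_axioms.intro group_PLB_ext E.group_axioms \<theta>)
  let ?S = "\<theta> ` carrier (PLB_ext n)" and ?o = "\<one>\<^bsub>Z2_pow n\<^esub>"
  show "?S \<subseteq> carrier E"
    by (metis \<theta>.hom_closed image_subsetI)
  have S: "subgroup ?S E"
    by (rule \<theta>.img_is_subgroup)
  have gen: "rep_gen x \<in> ?S" if x: "x \<in> plb_gens n" for x
  proof -
    have "rep_gen x \<in> carrier E"
      using rep_gen_closed x by (rule funcset_mem)
    then have "\<theta> (plb_letter n x) = rep_gen x"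
      using eval[of "[(x, True)]"] x
      by (simp only: word_eval.simps if_True E.r_one words_simps simp_thms)
    then show ?thesis
      using plb_letter_closed[OF x] by (metis imageI)
  qed
  have lattice_hom: "(\<lambda>z. (z, ?o)) \<in> hom (Z_pow m) E"
    by (rule homI)
      (simp_all only: semidirect_product_simps mem_Sigma_iff action.Q.one_closed action.Q.l_one
        action.rho_one simp_thms)
  have lattice: "(\<lambda>z. (z, ?o)) ` carrier (Z_pow m) \<subseteq> ?S"
  proof (rule hom_image_product_group_subset[OF _ _ lattice_hom S E.group_axioms])
    fix k and x :: int
    assume "k \<in> {1..m}"
    then obtain i j where ij: "(i, j) \<in> index_pairs n" "k = idx (i, j)"
      using idx by (metis bij_betw_def imageE surj_pair)
    have "(unit k, ?o) \<in> ?S"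
      using gen[of "Alpha i j"] ij by (simp only: rep_gen.simps plb_gens_simps) (simp add: index_pairs_def)
    then have "(unit k, ?o) [^]\<^bsub>E\<^esub> x \<in> ?S"
      by (rule E.subgroup_int_pow_closed[OF S])
    moreover have "(single {1..m} (\<lambda>_. integer_group) k x, ?o) = (unit k, ?o) [^]\<^bsub>E\<^esub> x"
    proof -
      have h: "(\<lambda>z. (z, ?o)) \<circ> single {1..m} (\<lambda>_. integer_group) k \<in> hom integer_group E"
        using single_hom[of "{1..m}" "\<lambda>_. integer_group" k] lattice_hom
        by (intro hom_compose[where H = "Z_pow m"]) simp_all
      show ?thesis
        using hom_int_pow[OF h _ group_integer_group E.group_axioms, of 1 x] by (simp only: comp_apply) simp
    qed
    ultimately show "(single {1..m} (\<lambda>_. integer_group) k x, ?o) \<in> ?S"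
      by (simp only:)
  qed simp_all
  have flip_hom: "(\<lambda>\<epsilon>. (\<one>\<^bsub>Z_pow m\<^esub>, \<epsilon>)) \<in> hom (Z2_pow n) E"
    by (rule homI) (simp_all only: semidirect_product_simps mem_Sigma_iff Z.one_closed
        action.rho_fixes_one Z.l_one simp_thms)
  have flips: "(\<lambda>\<epsilon>. (\<one>\<^bsub>Z_pow m\<^esub>, \<epsilon>)) ` carrier (Z2_pow n) \<subseteq> ?S"
  proof (rule hom_image_product_group_subset[OF _ _ flip_hom S E.group_axioms])
    fix i and x :: int
    assume i: "i \<in> {1..n}" and "x \<in> carrier (integer_mod_group 2)"
    then consider "x = 0" | "x = 1"
      by (force simp: carrier_integer_mod_group)
    then show "(\<one>\<^bsub>Z_pow m\<^esub>, single {1..n} (\<lambda>_. integer_mod_group 2) i x) \<in> ?S"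
    proof cases
      case 1
      then have "single {1..n} (\<lambda>_. integer_mod_group 2) i x = ?o"
        by (simp add: single_def fun_eq_iff)
      then show ?thesis
        using subgroup.one_closed[OF S] by (simp only: semidirect_product_simps)
    next
      case 2
      then show ?thesis
        using gen[of "Tau i"] i by (simp only: rep_gen.simps plb_gens_simps)
    qed
  qed simp_all
  show "carrier E \<subseteq> ?S"
  proof
    fix x assume "x \<in> carrier E"
    then obtain z \<epsilon> where x: "x = (z, \<epsilon>)" "z \<in> carrier (Z_pow m)" "\<epsilon> \<in> carrier (Z2_pow n)"
      by (metis SigmaE semidirect_product_simps(1))
    have "(z, ?o) \<otimes>\<^bsub>E\<^esub> (\<one>\<^bsub>Z_pow m\<^esub>, \<epsilon>) \<in> ?S"
      by (rule subgroup.m_closed[OF S subsetD[OF lattice imageI[OF x(2)]]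
            subsetD[OF flips imageI[OF x(3)]]])
    moreover have "(z, ?o) \<otimes>\<^bsub>E\<^esub> (\<one>\<^bsub>Z_pow m\<^esub>, \<epsilon>) = x"
      using x by (simp only: semidirect_product_simps action.rho_one Z.one_closed Z.r_one action.Q.l_one)
    ultimately show "x \<in> ?S"
      by (simp only:)
  qed
qed

lemma crystallographic_quotient:
  assumes "n \<ge> 2"
  shows "crystallographic (PLB_ext n Mod derived (PLB_ext n) (WP n)) m (Z2_pow n)"
proof -
  obtain \<theta> where \<theta>: "\<theta> \<in> hom (PLB_ext n) E"
    and eval: "\<And>w. w \<in> words (plb_gens n) \<Longrightarrow> \<theta> (plb_class n w) = word_eval E rep_gen w"
    using E.hom_from_presented_group[OF rep_gen_closed rep_gen_relations] unfolding PLB_ext_def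
    by blast
  interpret \<theta>: group_hom "PLB_ext n" E \<theta>
    by (intro group_hom.intro group_hom_axioms.intro group_PLB_ext E.group_axioms \<theta>)
  have N: "derived (PLB_ext n) (WP n) \<lhd> PLB_ext n"
    by (rule \<theta>.G.derived_is_normal[OF WP_normal])
  have "(\<lambda>X. the_elem (\<theta> ` X)) \<in> iso (PLB_ext n Mod derived (PLB_ext n) (WP n)) E"
    using \<theta>.FactGroup_iso_set rep_onto[OF \<theta> eval] kernel_rep[OF \<theta> eval] by (simp only:)
  moreover have "crystallographic E m (Z2_pow n)"
  proof (rule semidirect_product_crystallographic)
    show "finite (carrier (Z2_pow n))"
      by (auto simp: carrier_integer_mod_group intro!: finite_PiE)
  qed (use action.Q.group_axioms sign_rep_hom[OF target_in] sign_rep_inj[OF target_onto[OF assms]] in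
      blast)+
  ultimately show ?thesis
    using crystallographic_iso normal.factorgroup_is_group[OF N] by blast
qed

end

theorem theorem5p5:
  fixes n :: nat
  assumes "n \<ge> 2"
  shows "crystallographic (PLB_ext n Mod derived (PLB_ext n) (WP n)) (n * (n - 1)) (Z2_pow n)"
proof -
  have "finite (index_pairs n)"
    by (rule finite_subset[of _ "{1..n} \<times> {1..n}"]) (auto simp: index_pairs_def)
  then obtain idx where "bij_betw idx (index_pairs n) {1..n * (n - 1)}"
    using finite_same_card_bij[of "index_pairs n" "{1..n * (n - 1)}"] card_index_pairs by auto
  then interpret index_pair_numbering n "n * (n - 1)" idx
    by unfold_locales
  show ?thesis
    using assms by (rule crystallographic_quotient)
qed

end
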